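(* Let $\alpha>2$, $\lambda>0$, $p\in(0,1]$, $\theta,\Omega>0$, $n>0$, and let $m$ be a positive integer. Let $$\gamma=\frac{W}{Y+\sum_{\ell}|X_\ell|^{-\alpha}\Psi_{\ell 0}+1},$$ where $W\sim\mathrm{Gamma}(m,\theta)$; $\{X_\ell\}$ is a homogeneous Poisson point process on $\mathbb{R}^2$ of intensity $p\lambda$; the marks $\Psi_{\ell 0}$ are i.i.d. $\mathrm{Gamma}(n,\Omega)$; $Y$ is either $\mathrm{Gamma}(u,\Upsilon)$ with $u,\Upsilon>0$, or identically $0$; and $W$, $Y$, $\{X_\ell\}$, $\{\Psi_{\ell 0}\}$ are mutually independent. Then for every $\beta>0$ the c.d.f. $\mathrm{F}_\gamma(\beta)=\Pr(\gamma\le\beta)$ is $$\mathrm{F}_{\gamma}(\beta)=1-\frac{(-1)^{m-1}e^{-\lambda\left(\frac{\beta\Omega}{\theta}\right)^{2/\alpha}\eta(n)}e^{-\beta/\theta}}{\Gamma(m)}\sum_{\ell=0}^{m-1}\binom{m-1}{\ell}\left(-\frac{\beta}{\theta}\right)^{\ell}\sum_{i=0}^{m-\ell-1}s(m-\ell,i+1)\left(\frac{2}{\alpha}\right)^{i}\sum_{j=0}^{i}S(i,j)\left(-\lambda\left(\frac{\beta\Omega}{\theta}\right)^{2/\alpha}\eta(n)\right)^{j}\sum_{\tau=0}^{\ell}\binom{\ell}{\tau}\mathrm{E}_Y\left[e^{-\beta Y/\theta}Y^{\tau}\right],$$ where $$\eta(n)=\frac{\pi p\,\Gamma\left(n+\frac{2}{\alpha}\right)\Gamma\left(1-\frac{2}{\alpha}\right)}{\Gamma(n)},$$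 and, when $Y\sim\mathrm{Gamma}(u,\Upsilon)$, $$\mathrm{E}_Y\left[e^{-\beta Y/\theta}Y^{\tau}\right]=\frac{\Gamma(\tau+u)}{\Gamma(u)\Upsilon^{u}}\left(\frac{\beta}{\theta}+\frac{1}{\Upsilon}\right)^{-\tau-u}.$$
   Context: $\mathrm{Gamma}(v,\vartheta)$ denotes the gamma distribution with shape $v$ and scale $\vartheta$, i.e. density $x^{v-1}e^{-x/\vartheta}/(\Gamma(v)\vartheta^{v})$ on $x\ge 0$. $s(\cdot,\cdot)$ are the (signed) Stirling numbers of the first kind, so that $x(x-1)\cdots(x-q+1)=\sum_{j}s(q,j)x^{j}$, and $S(\cdot,\cdot)$ are the Stirling numbers of the second kind. Conventions: $0^0=1$ (so for $Y\equiv 0$ the expectation $\mathrm{E}_Y[e^{-\beta Y/\theta}Y^\tau]$ is $1$ if $\tau=0$ and $0$ otherwise), $S(0,0)=1$. The variable $\gamma$ models a signal-to-interference-and-noise ratio. *)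

theory Defs
  imports "HOL-Probability.Probability" "HOL-Combinatorics.Stirling"
begin

text \<open>The density of the gamma distribution with shape \<open>v\<close> and scale \<open>t\<close>
  (\<^const>\<open>erlang_density\<close> covers integer shapes only, and is parametrised by the rate).\<close>

definition gamma_density :: "real \<Rightarrow> real \<Rightarrow> real \<Rightarrow> real" where
  "gamma_density v t x =
     (if x < 0 then 0 else x powr (v - 1) * exp (- x / t) / (Gamma v * t powr v))"

text \<open>A point process is given by an enumeration \<open>X 0, X 1, \<dots>\<close> of its points.
  Points are counted by their indices, and the count may be infinite.\<close>

definition point_count :: "(nat \<Rightarrow> 'a \<Rightarrow> 'b) \<Rightarrow> 'b set \<Rightarrow> 'a \<Rightarrow> ennreal" where
  "point_count X B \<omega> = emeasure (count_space UNIV) {l. X l \<omega> \<in> B}"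

text \<open>The homogeneous Poisson point process of intensity \<open>c\<close>. The law of the counts is
  written out because \<^const>\<open>poisson_pmf\<close> excludes the rate \<open>0\<close>, which occurs for null
  sets \<open>B\<close>. The probabilities below sum to \<open>1\<close> over \<open>k\<close>, so a bounded set almost surely
  contains only finitely many points.\<close>

definition homogeneous_PPP ::
    "'a measure \<Rightarrow> real \<Rightarrow> (nat \<Rightarrow> 'a \<Rightarrow> 'b::euclidean_space) \<Rightarrow> bool" where
  "homogeneous_PPP M c X \<longleftrightarrow>
     (\<forall>l. X l \<in> borel_measurable M) \<and>
     (\<forall>B \<in> sets borel. bounded B \<longrightarrow>
        (\<forall>k::nat. measure M {\<omega> \<in> space M. point_count X B \<omega> = of_nat k} =
           (c * measure lborel B) ^ k / fact k * exp (- (c * measure lborel B)))) \<and>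
     (\<forall>(I::nat set) B. finite I \<longrightarrow> disjoint_family_on B I \<longrightarrow>
        (\<forall>i\<in>I. B i \<in> sets borel \<and> bounded (B i)) \<longrightarrow>
        prob_space.indep_vars M (\<lambda>_. borel) (\<lambda>i. point_count X (B i)) I)"

text \<open>The events generated by a random variable \<open>Z\<close> with values in \<open>N\<close>, as in the definition
  of independence of random variables; needed to state independence of
  random variables whose value types differ.\<close>

definition generated_events :: "'a measure \<Rightarrow> 'b measure \<Rightarrow> ('a \<Rightarrow> 'b) \<Rightarrow> 'a set set" where
  "generated_events M N Z = {Z -` A \<inter> space M | A. A \<in> sets N}"

text \<open>The real-valued infinite sum has nonnegative terms almost surely. It
  has a junk value where it diverges or where some \<open>X l \<omega> = 0\<close>; for a Poisson process
  with gamma marks and \<open>\<alpha> > 2\<close> these are null events.\<close>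

definition sinr ::
    "real \<Rightarrow> ('a \<Rightarrow> real) \<Rightarrow> ('a \<Rightarrow> real) \<Rightarrow> (nat \<Rightarrow> 'a \<Rightarrow> 'b::real_normed_vector) \<Rightarrow>
     (nat \<Rightarrow> 'a \<Rightarrow> real) \<Rightarrow> 'a \<Rightarrow> real" where
  "sinr \<alpha> W Y X \<Psi> \<omega> =
     W \<omega> / (Y \<omega> + (\<Sum>l. norm (X l \<omega>) powr (- \<alpha>) * \<Psi> l \<omega>) + 1)"

definition eta :: "real \<Rightarrow> real \<Rightarrow> real \<Rightarrow> real" where
  "eta \<alpha> p n = pi * p * Gamma (n + 2 / \<alpha>) * Gamma (1 - 2 / \<alpha>) / Gamma n"

text \<open>Signed Stirling numbers of the first kind. \<^const>\<open>stirling\<close> is the unsigned version,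
  and \<^const>\<open>Stirling\<close> is the second kind.\<close>

definition signed_stirling :: "nat \<Rightarrow> nat \<Rightarrow> int" where
  "signed_stirling q j = (- 1) ^ (q + j) * int (stirling q j)"

lemma signed_stirling_falling_factorial:
  fixes x :: "'a::comm_ring_1"
  shows "(\<Prod>i<q. x - of_nat i) = (\<Sum>j\<le>q. of_int (signed_stirling q j) * x ^ j)"
proof -
  have "(\<Prod>i<q. x - of_nat i) = (\<Prod>i<q. (- 1) * (- x + of_nat i))"
    by (intro prod.cong) auto
  also have "\<dots> = (- 1) ^ q * pochhammer (- x) q"
    by (subst prod.distrib) (simp add: pochhammer_prod atLeast0LessThan)
  also have "\<dots> = (\<Sum>j\<le>q. (- 1) ^ q * (of_nat (stirling q j) * (- x) ^ j))"
    by (simp add: sum_distrib_left flip: stirling_pochhammer)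
  also have "\<dots> = (\<Sum>j\<le>q. of_int (signed_stirling q j) * x ^ j)"
    by (intro sum.cong refl)
      (simp add: signed_stirling_def power_add power_minus[of x] mult_ac)
  finally show ?thesis .
qed

end

theory Submission
  imports Defs
begin

text \<open>Let \<open>z = \<beta> / \<theta>\<close>, let \<open>I\<close> be the interference \<open>\<Sum>l. norm (X l) powr - \<alpha> * \<Psi> l\<close>, and put
  \<open>T = Y + 1 + I\<close>. The survival function of \<open>W\<close> is that of an Erlang law, so \<open>P (\<gamma> > \<beta>)\<close> is the
  expectation of \<open>exp (- z T) * (\<Sum>k<m. (z T) ^ k / fact k)\<close>. By the binomial theorem and
  independence it reduces to moments of \<open>I\<close> and of \<open>Y\<close> under exponential tilting. Those of \<open>I\<close>
  come from its Laplace transform \<open>exp (- C * z powr \<delta>)\<close> with \<open>\<delta> = 2 / \<alpha>\<close>: the operator \<open>z d/dz\<close>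
  acts on it as \<open>\<delta> y d/dy\<close> with \<open>y = - C * z powr \<delta>\<close>, which produces the Stirling numbers of the
  second kind, and the partial sums of the tilted moments are falling factorials in \<open>z d/dz\<close>, which
  produce those of the first kind.

  The Laplace transform follows from the generating functional
  \<open>E (\<Prod>l. \<phi> (X l)) = exp (- c \<integral> (1 - \<phi>))\<close> of the Poisson process, applied to the Laplace transform \<open>\<phi>\<close>
  of a single weighted mark.\<close>

text \<open>Write D for \<open>z d/dz\<close>, L for the Laplace transform of \<open>I\<close>, and
  F_r for the expectation of \<open>I ^ r * exp (- (z * I))\<close>. Then F_r is (-1)^r times the
  r-th derivative of L, and z^r d^r/dz^r is the falling factorial D (D - 1) ... (D - r + 1). Hence
  z^r F_r / r! = (-1)^r binom(D, r) L, and the alternating sum over r up to q collapses to (-1)^q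
  binom(D - 1, q) L, that is, to (D - 1) ... (D - q) L up to the factor (-1)^q / q!. This product is
  the falling factorial of degree q + 1 divided by D, which is why D^i L carries a Stirling number
  with both indices raised by one. On the probabilistic side the obstacle is that convergence of
  \<open>I\<close> is not given. Products over all points are therefore infima of partial products
  in \<open>ennreal\<close>, which exist unconditionally; the marks are averaged out of finite
  products by Fubini before any limit is taken; and almost sure convergence of \<open>I\<close> is a
  consequence of the Laplace transform, not an input to it.\<close>

subsection \<open>Independence across value types\<close>

text \<open>Disjoint blocks of an independent family of Int-stable generators generate independent
  sigma-algebras. Generators are used because the variables differ in value type; arbitrary blocks,
  so that one hypothesis yields every product law needed: points with marks, \<open>Y + 1\<close>
  with the interference, the whole denominator with \<open>W\<close>.\<close>

lemma (in prob_space) distr_Pair_eq_pair_measure: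
  assumes indep: "indep_sets F K"
    and stable: "\<And>k. k \<in> K \<Longrightarrow> Int_stable (F k)"
    and AB: "A \<subseteq> K" "B \<subseteq> K" "A \<inter> B = {}"
    and S: "S \<in> measurable (sigma (space M) (\<Union>k\<in>A. F k)) N1"
    and T: "T \<in> measurable (sigma (space M) (\<Union>k\<in>B. F k)) N2"
  shows "S \<in> measurable M N1" "T \<in> measurable M N2"
    "distr M (N1 \<Otimes>\<^sub>M N2) (\<lambda>\<omega>. (S \<omega>, T \<omega>)) = distr M N1 S \<Otimes>\<^sub>M distr M N2 T"
proof -
  have ev: "(\<Union>k\<in>A. F k) \<subseteq> events" "(\<Union>k\<in>B. F k) \<subseteq> events"
    using indep AB unfolding indep_sets_def by blast+
  then have sp: "(\<Union>k\<in>A. F k) \<subseteq> Pow (space M)" "(\<Union>k\<in>B. F k) \<subseteq> Pow (space M)"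
    using sets.space_closed by blast+
  let ?I = "case_bool A B"
  have *: "indep_sets (\<lambda>j. sigma_sets (space M) (\<Union>i\<in>?I j. F i)) UNIV"
  proof (rule indep_sets_collect_sigma)
    show "indep_sets F (\<Union>j\<in>UNIV. ?I j)"
      using AB by (intro indep_sets_mono_index[OF _ indep]) (auto split: bool.splits)
    show "disjoint_family ?I"
      using AB by (auto simp: disjoint_family_on_def split: bool.splits)
  qed (use AB stable in \<open>auto split: bool.splits\<close>)
  have sub: "sigma_sets (space M) (\<Union>k\<in>A. F k) \<subseteq> events" "sigma_sets (space M) (\<Union>k\<in>B. F k) \<subseteq> events"
    using ev by (auto intro!: sets.sigma_sets_subset)
  have in_sigma: "S -` a \<inter> space M \<in> sigma_sets (space M) (\<Union>k\<in>A. F k)" if "a \<in> sets N1" for a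
    using measurable_sets[OF S that] sp by (simp add: sets_measure_of space_measure_of)
  have in_sigma': "T -` b \<inter> space M \<in> sigma_sets (space M) (\<Union>k\<in>B. F k)" if "b \<in> sets N2" for b
    using measurable_sets[OF T that] sp by (simp add: sets_measure_of space_measure_of)
  show S'[measurable]: "S \<in> measurable M N1"
    using S in_sigma sub sp by (auto simp: measurable_def space_measure_of)
  show T'[measurable]: "T \<in> measurable M N2"
    using T in_sigma' sub sp by (auto simp: measurable_def space_measure_of)
  have prod: "prob (S -` a \<inter> space M \<inter> (T -` b \<inter> space M))
      = prob (S -` a \<inter> space M) * prob (T -` b \<inter> space M)"
    if "a \<in> sets N1" "b \<in> sets N2" for a b
    using indep_setsD[OF *, of UNIV "case_bool (S -` a \<inter> space M) (T -` b \<inter> space M)"]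
      in_sigma[OF that(1)] in_sigma'[OF that(2)]
    by (simp add: UNIV_bool all_bool_eq Int_commute mult.commute)
  interpret S: prob_space "distr M N1 S" by (rule prob_space_distr) simp
  interpret T: prob_space "distr M N2 T" by (rule prob_space_distr) simp
  show "distr M (N1 \<Otimes>\<^sub>M N2) (\<lambda>\<omega>. (S \<omega>, T \<omega>)) = distr M N1 S \<Otimes>\<^sub>M distr M N2 T"
  proof (rule sym, rule pair_measure_eqI)
    fix a b assume [measurable]: "a \<in> sets (distr M N1 S)" "b \<in> sets (distr M N2 T)"
    then have "a \<in> sets N1" "b \<in> sets N2" by auto
    have "(\<lambda>\<omega>. (S \<omega>, T \<omega>)) -` (a \<times> b) \<inter> space M = S -` a \<inter> space M \<inter> (T -` b \<inter> space M)"
      by auto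
    then show "emeasure (distr M N1 S) a * emeasure (distr M N2 T) b
        = emeasure (distr M (N1 \<Otimes>\<^sub>M N2) (\<lambda>\<omega>. (S \<omega>, T \<omega>))) (a \<times> b)"
      using \<open>a \<in> sets N1\<close> \<open>b \<in> sets N2\<close>
      by (simp add: emeasure_distr emeasure_eq_measure prod ennreal_mult')
  qed (auto intro: S.sigma_finite_measure_axioms T.sigma_finite_measure_axioms)
qed

lemma Int_stable_generated_events: "Int_stable (generated_events M N Z)"
proof (rule Int_stableI)
  fix a b assume "a \<in> generated_events M N Z" "b \<in> generated_events M N Z"
  then obtain A B where "a = Z -` A \<inter> space M" "b = Z -` B \<inter> space M" "A \<in> sets N" "B \<in> sets N"
    by (auto simp: generated_events_def)
  then have "a \<inter> b = Z -` (A \<inter> B) \<inter> space M" "A \<inter> B \<in> sets N"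
    by auto
  then show "a \<inter> b \<in> generated_events M N Z"
    unfolding generated_events_def by blast
qed

lemma measurable_generated_events:
  assumes "generated_events M N Z \<subseteq> G" "G \<subseteq> Pow (space M)" "Z \<in> space M \<rightarrow> space N"
  shows "Z \<in> measurable (sigma (space M) G) N"
  using assms by (auto simp: measurable_def generated_events_def space_measure_of sets_measure_of)

subsection \<open>The generating functional of a Poisson process\<close>

text \<open>For factors in [0, 1] the partial products decrease, so the infimum is the infinite
  product, with value 0 where that product diverges to 0; no convergence has to be shown
  first.\<close>

definition point_prod :: "(nat \<Rightarrow> 'a \<Rightarrow> 'b) \<Rightarrow> ('b \<Rightarrow> real) \<Rightarrow> 'a \<Rightarrow> ennreal" where
  "point_prod X \<phi> \<omega> = (INF N. \<Prod>l<N. ennreal (\<phi> (X l \<omega>)))"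

lemma prod_mono_ennreal:
  "(\<And>i. i \<in> I \<Longrightarrow> f i \<le> g i) \<Longrightarrow> (\<Prod>i\<in>I. f i) \<le> (\<Prod>i\<in>I. g i :: ennreal)"
  by (induction I rule: infinite_finite_induct) (auto intro: mult_mono)

lemma point_prod_le_1: "point_prod X \<phi> \<omega> \<le> 1"
  unfolding point_prod_def by (rule INF_lower2[of 0]) auto

text \<open>Only points in \<open>D\<close> contribute factors other than 1, so the partial products
  are constant after the last index of such a point.\<close>

lemma point_prod_finite:
  assumes "finite {l. X l \<omega> \<in> D}" "\<And>x. 0 \<le> \<phi> x" "\<And>x. \<phi> x \<le> 1" "\<And>x. x \<notin> D \<Longrightarrow> \<phi> x = 1"
  shows "point_prod X \<phi> \<omega> = ennreal (\<Prod>l | X l \<omega> \<in> D. \<phi> (X l \<omega>))"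
proof -
  let ?S = "{l. X l \<omega> \<in> D}"
  have P: "ennreal (\<Prod>l\<in>?S. \<phi> (X l \<omega>)) = (\<Prod>l\<in>?S. ennreal (\<phi> (X l \<omega>)))"
    using assms by (simp add: prod_ennreal)
  have eq: "(\<Prod>l<N. ennreal (\<phi> (X l \<omega>))) = (\<Prod>l\<in>{..<N} \<inter> ?S. ennreal (\<phi> (X l \<omega>)))" for N
    using assms(4) by (intro prod.mono_neutral_right) auto
  show ?thesis
    unfolding P point_prod_def
  proof (rule antisym)
    obtain N where "\<forall>l\<in>?S. l < N"
      using assms(1) finite_nat_set_iff_bounded by blast
    then have "{..<N} \<inter> ?S = ?S" by auto
    then show "(INF N. \<Prod>l<N. ennreal (\<phi> (X l \<omega>))) \<le> (\<Prod>l\<in>?S. ennreal (\<phi> (X l \<omega>)))"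
      by (intro INF_lower2[of N]) (simp_all add: eq)
  next
    show "(\<Prod>l\<in>?S. ennreal (\<phi> (X l \<omega>))) \<le> (INF N. \<Prod>l<N. ennreal (\<phi> (X l \<omega>)))"
    proof (rule INF_greatest)
      fix N
      have "(\<Prod>l\<in>?S. ennreal (\<phi> (X l \<omega>)))
          = (\<Prod>l\<in>?S - {..<N}. ennreal (\<phi> (X l \<omega>))) * (\<Prod>l\<in>?S \<inter> {..<N}. ennreal (\<phi> (X l \<omega>)))"
        using assms(1) prod.Int_Diff[of ?S "\<lambda>l. ennreal (\<phi> (X l \<omega>))" "{..<N}"] by (simp add: mult.commute)
      also have "\<dots> \<le> 1 * (\<Prod>l\<in>?S \<inter> {..<N}. ennreal (\<phi> (X l \<omega>)))"
        using assms(3) prod_mono_ennreal[of "?S - {..<N}" "\<lambda>l. ennreal (\<phi> (X l \<omega>))" "\<lambda>_. 1"]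
        by (intro mult_right_mono) (auto simp: ennreal_le_1)
      finally show "(\<Prod>l\<in>?S. ennreal (\<phi> (X l \<omega>))) \<le> (\<Prod>l<N. ennreal (\<phi> (X l \<omega>)))"
        by (simp add: eq Int_commute)
    qed
  qed
qed

lemma measurable_point_prod:
  assumes [measurable]: "\<And>l. X l \<in> borel_measurable M" "\<phi> \<in> borel_measurable borel"
  shows "point_prod X \<phi> \<in> borel_measurable M"
  unfolding point_prod_def by measurable

context prob_space
begin

text \<open>Measurability of the counts is hidden in the independence clause of the process:
  \<open>indep_vars\<close> includes it, so a one-element index set suffices.\<close>

lemma measurable_point_count:
  assumes "homogeneous_PPP M c X" "B \<in> sets borel" "bounded B"
  shows "point_count X B \<in> borel_measurable M"
proof -
  have "indep_vars (\<lambda>_. borel) (\<lambda>i. point_count X B) {0::nat}"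
    using assms unfolding homogeneous_PPP_def
    by (elim conjE) (drule spec[of _ "{0}"], drule spec[of _ "\<lambda>_. B"], auto simp: disjoint_family_on_def)
  then show ?thesis
    by (simp add: indep_vars_def)
qed

text \<open>The second claim is the probability generating function of the Poisson law. The events
  that the count equals some \<open>k\<close> have total mass 1, so an infinite count is a null
  event; there \<open>enn2real\<close> would give exponent 0, elsewhere \<open>nat\<close> and the
  floor recover \<open>k\<close>.\<close>

lemma
  assumes X: "homogeneous_PPP M c X" and c: "c \<ge> 0" and B: "B \<in> sets borel" "bounded B"
  shows AE_point_count_finite: "AE \<omega> in M. finite {l. X l \<omega> \<in> B}"
    and nn_integral_power_point_count: "0 \<le> a \<Longrightarrow>
      (\<integral>\<^sup>+\<omega>. ennreal (a ^ nat \<lfloor>enn2real (point_count X B \<omega>)\<rfloor>) \<partial>M)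
        = ennreal (exp (- (c * measure lborel B * (1 - a))))"
proof -
  let ?c = "c * measure lborel B"
  note measurable_point_count[OF X B, measurable]
  have pr: "prob {\<omega> \<in> space M. point_count X B \<omega> = of_nat k} = ?c ^ k / fact k * exp (- ?c)" for k
    using X B unfolding homogeneous_PPP_def by blast
  have exp_sums: "(\<lambda>k. ?c ^ k / fact k * exp (- ?c) * a ^ k) sums exp (- (?c * (1 - a)))" for a
  proof -
    have "(\<lambda>k. exp (- ?c) * ((?c * a) ^ k /\<^sub>R fact k)) sums (exp (- ?c) * exp (?c * a))"
      by (intro sums_mult exp_converges)
    then show ?thesis
      by (simp add: power_mult_distrib divide_inverse mult_ac algebra_simps flip: exp_add)
  qed
  have "(\<lambda>k. prob {\<omega> \<in> space M. point_count X B \<omega> = of_nat k})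
      sums prob (\<Union>k. {\<omega> \<in> space M. point_count X B \<omega> = of_nat k})"
    by (intro finite_measure_UNION) (auto simp: disjoint_family_on_def)
  \<comment> \<open>At \<open>a = 1\<close> the series is the sum of the Poisson weights.\<close>
  with exp_sums[of 1] have "prob (\<Union>k. {\<omega> \<in> space M. point_count X B \<omega> = of_nat k}) = 1"
    by (simp add: pr sums_iff)
  then have AE: "AE \<omega> in M. \<exists>k. point_count X B \<omega> = of_nat k"
    by (auto dest!: AE_prob_1)
  then show "AE \<omega> in M. finite {l. X l \<omega> \<in> B}"
    by eventually_elim (auto simp: point_count_def emeasure_count_space split: if_splits)
  assume a: "0 \<le> a"
  have "(\<integral>\<^sup>+\<omega>. ennreal (a ^ nat \<lfloor>enn2real (point_count X B \<omega>)\<rfloor>) \<partial>M)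
      = (\<integral>\<^sup>+\<omega>. (\<Sum>k. ennreal (a ^ k) * indicator {\<omega> \<in> space M. point_count X B \<omega> = of_nat k} \<omega>) \<partial>M)"
    using AE AE_space[of M]
  proof (intro nn_integral_cong_AE, eventually_elim)
    case (elim \<omega>)
    then obtain k where k: "point_count X B \<omega> = of_nat k" "\<omega> \<in> space M" by auto
    have "(\<Sum>i. ennreal (a ^ i) * indicator {\<omega> \<in> space M. point_count X B \<omega> = of_nat i} \<omega>)
        = (\<Sum>i\<in>{k}. ennreal (a ^ i) * indicator {\<omega> \<in> space M. point_count X B \<omega> = of_nat i} \<omega>)"
      using k by (intro suminf_finite) auto
    then show ?case
      using k by simp
  qed
  also have "\<dots> = (\<Sum>k. ennreal (a ^ k) * emeasure M {\<omega> \<in> space M. point_count X B \<omega> = of_nat k})"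
    by (subst nn_integral_suminf) (auto simp: nn_integral_cmult)
  also have "\<dots> = (\<Sum>k. ennreal (?c ^ k / fact k * exp (- ?c) * a ^ k))"
    using a c by (intro suminf_cong) (simp add: emeasure_eq_measure pr ennreal_mult'[symmetric] mult_ac)
  also have "\<dots> = ennreal (exp (- (?c * (1 - a))))"
    using a c by (intro suminf_ennreal_eq exp_sums) auto
  finally show "(\<integral>\<^sup>+\<omega>. ennreal (a ^ nat \<lfloor>enn2real (point_count X B \<omega>)\<rfloor>) \<partial>M)
        = ennreal (exp (- (?c * (1 - a))))" .
qed

text \<open>Sorting the points in \<open>D\<close> by their class \<open>\<iota>\<close> turns the
  product into powers of the \<open>a i\<close> with the counts as exponents. The classes are
  disjoint and bounded, so the counts are independent and each power has a known mean. Points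
  outside \<open>D\<close> have factor 1 and are left out, which keeps the classes bounded.\<close>

lemma nn_integral_point_prod_discrete:
  fixes X :: "nat \<Rightarrow> 'a \<Rightarrow> 'b::euclidean_space"
  assumes X: "homogeneous_PPP M c X" and c: "c \<ge> 0" and D: "D \<in> sets borel" "bounded D"
    and \<iota>[measurable]: "\<iota> \<in> measurable borel (count_space UNIV)" and \<iota>_le: "\<And>x. \<iota> x \<le> (k::nat)"
    and a: "\<And>i. 0 \<le> a i" "\<And>i. i \<le> k \<Longrightarrow> a i \<le> 1" and off: "\<And>x. x \<notin> D \<Longrightarrow> a (\<iota> x) = (1::real)"
  shows "(\<integral>\<^sup>+\<omega>. point_prod X (\<lambda>x. a (\<iota> x)) \<omega> \<partial>M) = ennreal (exp (- (c * (\<integral>x. 1 - a (\<iota> x) \<partial>lborel))))"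
proof -
  define B where "B i = {x \<in> D. \<iota> x = i}" for i
  have [measurable]: "D \<in> sets borel" by (fact D)
  have B: "B i \<in> sets borel" "bounded (B i)" for i
    using D(2) unfolding B_def by (measurable, auto intro: bounded_subset)
  let ?h = "\<lambda>i y. ennreal (a i ^ nat \<lfloor>enn2real y\<rfloor>)"
  have indep: "indep_vars (\<lambda>_. borel) (\<lambda>i. point_count X (B i)) {..k}"
    using X B unfolding homogeneous_PPP_def
    by (elim conjE) (drule spec[of _ "{..k}"], drule spec[of _ B],
      auto simp: disjoint_family_on_def B_def)
  have int: "1 - a (\<iota> x) = (\<Sum>i\<le>k. (1 - a i) * indicator (B i) x)" for x
  proof (cases "x \<in> D")
    case True
    have "(\<Sum>i\<le>k. (1 - a i) * indicator (B i) x) = (\<Sum>i\<in>{\<iota> x}. (1 - a i) * indicator (B i) x)"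
      using \<iota>_le by (intro sum.mono_neutral_right) (auto simp: B_def)
    then show ?thesis
      using True by (simp add: B_def)
  qed (simp add: off B_def)
  have "(\<integral>\<^sup>+\<omega>. point_prod X (\<lambda>x. a (\<iota> x)) \<omega> \<partial>M) = (\<integral>\<^sup>+\<omega>. (\<Prod>i\<le>k. ?h i (point_count X (B i) \<omega>)) \<partial>M)"
    using AE_point_count_finite[OF X c D]
  proof (intro nn_integral_cong_AE, eventually_elim)
    case (elim \<omega>)
    have "point_prod X (\<lambda>x. a (\<iota> x)) \<omega> = ennreal (\<Prod>l | X l \<omega> \<in> D. a (\<iota> (X l \<omega>)))"
      using elim a off \<iota>_le by (intro point_prod_finite) auto
    also have "(\<Prod>l | X l \<omega> \<in> D. a (\<iota> (X l \<omega>)))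
        = (\<Prod>i\<le>k. \<Prod>l\<in>{l \<in> {l. X l \<omega> \<in> D}. \<iota> (X l \<omega>) = i}. a (\<iota> (X l \<omega>)))"
      using elim \<iota>_le by (intro prod.group[symmetric]) auto
    also have "\<dots> = (\<Prod>i\<le>k. a i ^ card {l. X l \<omega> \<in> B i})"
      by (intro prod.cong refl) (simp add: B_def)
    also have "ennreal \<dots> = (\<Prod>i\<le>k. ennreal (a i ^ card {l. X l \<omega> \<in> B i}))"
      using a by (simp add: prod_ennreal)
    also have "\<dots> = (\<Prod>i\<le>k. ?h i (point_count X (B i) \<omega>))"
    proof (intro prod.cong refl)
      fix i
      have "finite {l. X l \<omega> \<in> B i}"
        by (rule finite_subset[OF _ elim(2)]) (auto simp: B_def)
      then show "ennreal (a i ^ card {l. X l \<omega> \<in> B i}) = ?h i (point_count X (B i) \<omega>)"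
        by (simp add: point_count_def emeasure_count_space)
    qed
    finally show ?case .
  qed
  also have "\<dots> = (\<Prod>i\<le>k. \<integral>\<^sup>+\<omega>. ?h i (point_count X (B i) \<omega>) \<partial>M)"
    by (intro indep_vars_nn_integral indep_vars_compose2[OF indep]) auto
  also have "\<dots> = (\<Prod>i\<le>k. ennreal (exp (- (c * measure lborel (B i) * (1 - a i)))))"
    by (intro prod.cong refl nn_integral_power_point_count[OF X c B] a)
  also have "\<dots> = ennreal (exp (- (c * (\<Sum>i\<le>k. (1 - a i) * measure lborel (B i)))))"
    by (simp add: prod_ennreal exp_sum[symmetric] sum_negf sum_distrib_left mult_ac)
  also have "(\<Sum>i\<le>k. (1 - a i) * measure lborel (B i)) = (\<integral>x. 1 - a (\<iota> x) \<partial>lborel)"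
    unfolding int using B
    by (subst Bochner_Integration.integral_sum)
      (auto intro!: integrable_mult_right integrable_real_indicator emeasure_bounded_finite)

  finally show ?thesis .
qed

text \<open>Rounding \<open>\<phi>\<close> down to multiples of \<open>1 / (k + 1)\<close> reduces the claim to the discrete case. Off
  \<open>D\<close>, where \<open>\<phi> = 1\<close>, the rounding changes nothing.\<close>

lemma nn_integral_point_prod_bounded:
  fixes X :: "nat \<Rightarrow> 'a \<Rightarrow> 'b::euclidean_space"
  assumes X: "homogeneous_PPP M c X" and c: "c \<ge> 0" and D: "D \<in> sets borel" "bounded D"
    and \<phi>[measurable]: "\<phi> \<in> borel_measurable borel"
    and \<phi>_bounds: "\<And>x. 0 \<le> \<phi> x" "\<And>x. \<phi> x \<le> 1" and off: "\<And>x. x \<notin> D \<Longrightarrow> \<phi> x = (1::real)"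
  shows "(\<integral>\<^sup>+\<omega>. point_prod X \<phi> \<omega> \<partial>M) = ennreal (exp (- (c * (\<integral>x. 1 - \<phi> x \<partial>lborel))))"
proof -
  define \<iota> where "\<iota> k x = nat \<lfloor>real (Suc k) * \<phi> x\<rfloor>" for k x
  define \<psi> where "\<psi> k x = real (\<iota> k x) / real (Suc k)" for k x
  have [measurable]: "X l \<in> borel_measurable M" for l
    using X by (simp add: homogeneous_PPP_def)
  have [measurable]: "D \<in> sets borel" by (fact D)
  have \<iota>_meas[measurable]: "\<iota> k \<in> measurable borel (count_space UNIV)" for k
    unfolding \<iota>_def by measurable
  have [measurable]: "\<psi> k \<in> borel_measurable borel" for k
    unfolding \<psi>_def by measurable
  have \<iota>_real: "real (\<iota> k x) = of_int \<lfloor>real (Suc k) * \<phi> x\<rfloor>" for k x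
    using \<phi>_bounds(1)[of x] unfolding \<iota>_def by (intro of_nat_nat) auto
  have \<iota>_le: "\<iota> k x \<le> Suc k" for k x
  proof -
    have "real (Suc k) * \<phi> x \<le> real (Suc k) * 1"
      using \<phi>_bounds(2)[of x] by (intro mult_left_mono) auto
    then have "\<lfloor>real (Suc k) * \<phi> x\<rfloor> \<le> int (Suc k)"
      unfolding mult_1_right by (metis floor_mono floor_of_nat)
    then show ?thesis
      unfolding \<iota>_def by linarith
  qed
  have off': "\<psi> k x = 1" if "x \<notin> D" for k x
    using off[OF that] by (simp add: \<psi>_def \<iota>_real)
  have \<psi>_bounds: "0 \<le> \<psi> k x" "\<psi> k x \<le> 1" for k x
    using \<iota>_le[of k x] by (auto simp: \<psi>_def)
  have lim: "(\<lambda>k. \<psi> k x) \<longlonglongrightarrow> \<phi> x" for x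
  proof (rule tendsto_sandwich[OF always_eventually always_eventually])
    show "\<forall>k. \<phi> x - 1 / real (Suc k) \<le> \<psi> k x"
    proof
      fix k
      have "real (Suc k) * \<phi> x - 1 \<le> real (\<iota> k x)"
        unfolding \<iota>_real by linarith
      from divide_right_mono[OF this, of "real (Suc k)"] show "\<phi> x - 1 / real (Suc k) \<le> \<psi> k x"
        by (simp add: \<psi>_def diff_divide_distrib del: of_nat_Suc)
    qed
    show "\<forall>k. \<psi> k x \<le> \<phi> x"
    proof
      fix k
      have "real (\<iota> k x) \<le> real (Suc k) * \<phi> x"
        unfolding \<iota>_real by linarith
      then show "\<psi> k x \<le> \<phi> x"
        by (simp add: \<psi>_def field_simps)
    qed
    show "(\<lambda>k. \<phi> x - 1 / real (Suc k)) \<longlonglongrightarrow> \<phi> x"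
      using tendsto_diff[OF tendsto_const LIMSEQ_Suc[OF lim_1_over_n]] by simp
  qed simp
  \<comment> \<open>Rounding to multiples of \<open>1 / (k + 1)\<close> is not monotone in
    \<open>k\<close>, so the limit is taken by dominated convergence under the bound 1.\<close>
  have "(\<lambda>k. \<integral>\<^sup>+\<omega>. point_prod X (\<psi> k) \<omega> \<partial>M) \<longlonglongrightarrow> (\<integral>\<^sup>+\<omega>. point_prod X \<phi> \<omega> \<partial>M)"
  proof (rule nn_integral_dominated_convergence[where w = "\<lambda>_. 1"])
    show "AE \<omega> in M. (\<lambda>k. point_prod X (\<psi> k) \<omega>) \<longlonglongrightarrow> point_prod X \<phi> \<omega>"
      using AE_point_count_finite[OF X c D]
    proof eventually_elim
      case (elim \<omega>)
      \<comment> \<open>With finitely many points in \<open>D\<close> both products are finite,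
        hence continuous in their factors.\<close>
      have "point_prod X (\<psi> k) \<omega> = ennreal (\<Prod>l | X l \<omega> \<in> D. \<psi> k (X l \<omega>))" for k
        by (intro point_prod_finite elim \<psi>_bounds off')
      moreover have "point_prod X \<phi> \<omega> = ennreal (\<Prod>l | X l \<omega> \<in> D. \<phi> (X l \<omega>))"
        by (intro point_prod_finite elim \<phi>_bounds off)
      ultimately show ?case
        by (auto intro!: tendsto_ennrealI tendsto_prod lim)
    qed
  qed (auto intro: measurable_point_prod simp: point_prod_le_1 emeasure_space_1)
  moreover have "(\<integral>\<^sup>+\<omega>. point_prod X (\<psi> k) \<omega> \<partial>M) = ennreal (exp (- (c * (\<integral>x. 1 - \<psi> k x \<partial>lborel))))" for k
    unfolding \<psi>_def
    by (rule nn_integral_point_prod_discrete[OF X c D \<iota>_meas \<iota>_le])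
      (use off' in \<open>auto simp: \<psi>_def divide_simps\<close>)
  ultimately have lim': "(\<lambda>k. ennreal (exp (- (c * (\<integral>x. 1 - \<psi> k x \<partial>lborel)))))
      \<longlonglongrightarrow> (\<integral>\<^sup>+\<omega>. point_prod X \<phi> \<omega> \<partial>M)"
    by simp
  have "(\<lambda>k. ennreal (exp (- (c * (\<integral>x. 1 - \<psi> k x \<partial>lborel)))))
      \<longlonglongrightarrow> ennreal (exp (- (c * (\<integral>x. 1 - \<phi> x \<partial>lborel))))"
  proof (intro tendsto_ennrealI tendsto_exp tendsto_minus tendsto_mult tendsto_const
      integral_dominated_convergence[where w = "indicator D"])
    show "integrable lborel (indicator D :: 'b \<Rightarrow> real)"
      using D by (intro integrable_real_indicator emeasure_bounded_finite) auto
    show "AE x in lborel. norm (1 - \<psi> k x) \<le> indicator D x" for k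
      using \<psi>_bounds off' by (auto simp: indicator_def)
  qed (auto intro!: tendsto_intros lim)
  with lim' show ?thesis
    by (rule LIMSEQ_unique)
qed

text \<open>Setting \<open>\<phi>\<close> to 1 outside the ball of radius \<open>R\<close> reduces
  the claim to the bounded case. The truncations decrease in \<open>R\<close>, so the infimum over
  \<open>R\<close> commutes with the one over partial products and, by monotone convergence, with
  the expectation; in the exponent \<open>1 - \<phi>\<close> is the dominating function.\<close>

theorem nn_integral_point_prod:
  fixes X :: "nat \<Rightarrow> 'a \<Rightarrow> 'b::euclidean_space"
  assumes X: "homogeneous_PPP M c X" and c: "c \<ge> 0"
    and \<phi>[measurable]: "\<phi> \<in> borel_measurable borel"
    and \<phi>_bounds: "\<And>x. 0 \<le> \<phi> x" "\<And>x. \<phi> x \<le> 1"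
    and int: "integrable lborel (\<lambda>x. 1 - \<phi> x :: real)"
  shows "(\<integral>\<^sup>+\<omega>. point_prod X \<phi> \<omega> \<partial>M) = ennreal (exp (- (c * (\<integral>x. 1 - \<phi> x \<partial>lborel))))"
proof -
  define \<psi> where "\<psi> R x = (if norm x \<le> real R then
 \<phi> x else 1)" for R :: nat and x
  have [measurable]: "X l \<in> borel_measurable M" for l
    using X by (simp add: homogeneous_PPP_def)
  have \<psi>_meas[measurable]: "\<psi> R \<in> borel_measurable borel" for R
    unfolding \<psi>_def by measurable
  have dec: "\<psi> (Suc R) x \<le> \<psi> R x" for R x
    using \<phi>_bounds by (auto simp: \<psi>_def)
  have \<psi>_ge: "\<phi> x \<le> \<psi> R x" for R x
    using \<phi>_bounds by (auto simp: \<psi>_def)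
  have \<psi>_bounds: "0 \<le> \<psi> R x" "\<psi> R x \<le> 1" for R x
    using \<phi>_bounds by (auto simp: \<psi>_def)
  have mono: "point_prod X (\<psi> (Suc R)) \<omega> \<le> point_prod X (\<psi> R) \<omega>" for R \<omega>
    unfolding point_prod_def by (intro INF_mono') (auto intro!: prod_mono_ennreal ennreal_leI dec)
  have "point_prod X \<phi> \<omega> = (INF R. point_prod X (\<psi> R) \<omega>)" for \<omega>
  proof -
    have "(INF R. \<Prod>l<N. ennreal (\<psi> R (X l \<omega>))) = (\<Prod>l<N. ennreal (\<phi> (X l \<omega>)))" for N
    proof (rule antisym)
      \<comment> \<open>Only the first \<open>N\<close> points matter, and they lie in some ball, so
        the infimum over \<open>R\<close> is attained. The inserted \<open>0\<close> keeps
        \<open>Max\<close> meaningful for \<open>N = 0\<close>.\<close>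
      obtain R :: nat where R: "Max (insert 0 ((\<lambda>l. norm (X l \<omega>)) ` {..<N})) \<le> real R"
        using real_arch_simple by blast
      have "norm (X l \<omega>) \<le> real R" if "l < N" for l
        using that by (intro order_trans[OF Max_ge R]) auto
      then show "(INF R. \<Prod>l<N. ennreal (\<psi> R (X l \<omega>))) \<le> (\<Prod>l<N. ennreal (\<phi> (X l \<omega>)))"
        by (intro INF_lower2[of R]) (auto simp: \<psi>_def intro!: prod_mono_ennreal)
    qed (auto intro!: INF_greatest prod_mono_ennreal ennreal_leI \<psi>_ge)
    then show ?thesis
      unfolding point_prod_def by (subst INF_commute) simp
  qed
  then have "(\<integral>\<^sup>+\<omega>. point_prod X \<phi> \<omega> \<partial>M) = (INF R. \<integral>\<^sup>+\<omega>. point_prod X (\<psi> R) \<omega> \<partial>M)"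
    using nn_integral_mono[of M "point_prod X (\<psi> 0)" "\<lambda>_. 1"]
    by (simp, intro nn_integral_monotone_convergence_INF_AE[where i = 0])
      (auto simp: mono point_prod_le_1 emeasure_space_1 intro: measurable_point_prod le_less_trans)
  moreover have "(\<lambda>R. \<integral>\<^sup>+\<omega>. point_prod X (\<psi> R) \<omega> \<partial>M) \<longlonglongrightarrow> (INF R. \<integral>\<^sup>+\<omega>. point_prod X (\<psi> R) \<omega> \<partial>M)"
    by (intro LIMSEQ_INF decseq_SucI nn_integral_mono mono)
  moreover have "(\<integral>\<^sup>+\<omega>. point_prod X (\<psi> R) \<omega> \<partial>M) = ennreal (exp (- (c * (\<integral>x. 1 - \<psi> R x \<partial>lborel))))" for R
    by (rule nn_integral_point_prod_bounded[OF X c, where D = "cball 0 (real R)"])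
      (auto simp: \<psi>_bounds, auto simp: \<psi>_def)
  ultimately have lim: "(\<lambda>R. ennreal (exp (- (c * (\<integral>x. 1 - \<psi> R x \<partial>lborel)))))
      \<longlonglongrightarrow> (\<integral>\<^sup>+\<omega>. point_prod X \<phi> \<omega> \<partial>M)"
    by simp
  have "(\<lambda>R. ennreal (exp (- (c * (\<integral>x. 1 - \<psi> R x \<partial>lborel)))))
      \<longlonglongrightarrow> ennreal (exp (- (c * (\<integral>x. 1 - \<phi> x \<partial>lborel))))"
  proof (intro tendsto_ennrealI tendsto_exp tendsto_minus tendsto_mult tendsto_const
      integral_dominated_convergence[OF _ _ int])
    show "AE x in lborel. norm (1 - \<psi> R x) \<le> 1 - \<phi> x" for R
      using \<phi>_bounds by (auto simp: \<psi>_def)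
    show "AE x in lborel. (\<lambda>R. 1 - \<psi> R x) \<longlonglongrightarrow> 1 - \<phi> x"
    proof (intro AE_I2 tendsto_eventually)
      fix x :: 'b
      obtain R :: nat where "norm x \<le> real R"
        using real_arch_simple by blast
      then show "\<forall>\<^sub>F R in sequentially. 1 - \<psi> R x = 1 - \<phi> x"
        unfolding eventually_sequentially by (intro exI[of _ R]) (auto simp: \<psi>_def)
    qed
  qed auto
  with lim show ?thesis
    by (rule LIMSEQ_unique)
qed

end

subsection \<open>Path loss and gamma integrals\<close>

lemma nn_integral_exp_interval:
  assumes "(u::real) \<ge> 0"
  shows "(\<integral>\<^sup>+t. ennreal (exp (- t)) * indicator {0<..u} t \<partial>lborel) = ennreal (1 - exp (- u))"
proof -
  have "(\<integral>\<^sup>+t. ennreal (exp (- t)) * indicator {0..u} t \<partial>lborel) = ennreal ((- exp (- u)) - (- exp (- 0)))"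
    using assms by (intro nn_integral_FTC_Icc) (auto intro!: derivative_eq_intros)
  moreover have "(\<integral>\<^sup>+t. ennreal (exp (- t)) * indicator {0<..u} t \<partial>lborel)
      = (\<integral>\<^sup>+t. ennreal (exp (- t)) * indicator {0..u} t \<partial>lborel)"
    using AE_lborel_singleton[of "0::real"]
    by (intro nn_integral_cong_AE) (auto elim!: eventually_mono simp: indicator_def)
  ultimately show ?thesis
    by simp
qed

text \<open>Layer cake: \<open>1 - exp (- u)\<close> is the integral of \<open>exp (- t)\<close> over \<open>0 < t \<le> u\<close>, and
  \<open>{x. t \<le> a * norm x powr - \<alpha>}\<close> is a punctured disc of area \<open>pi * (a / t) powr (2 / \<alpha>)\<close>.\<close>

lemma nn_integral_one_minus_exp_norm_powr:
  fixes a \<alpha> :: real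
  assumes \<alpha>: "\<alpha> > 2" and a: "a \<ge> 0"
  shows "(\<integral>\<^sup>+x. ennreal (1 - exp (- (a * norm (x::real^2) powr (- \<alpha>)))) \<partial>lborel)
    = ennreal (pi * a powr (2 / \<alpha>) * Gamma (1 - 2 / \<alpha>))"
proof -
  let ?d = "2 / \<alpha>"
  let ?f = "\<lambda>(x::real^2) (t::real). ennreal (exp (- t)) * indicator {0<..a * norm x powr (- \<alpha>)} t"
  \<comment> \<open>The right-hand side has the shape of the integrand in
    \<open>Gamma_conv_nn_integral_real\<close> at \<open>1 - ?d\<close>, which is positive because
    \<open>\<alpha> > 2\<close>. At \<open>t = 0\<close> both sides vanish, the right one because
    \<open>0 powr b\<close> is \<open>0\<close>.\<close>
  have area: "(\<integral>\<^sup>+x. ?f x t \<partial>lborel) = ennreal (pi * a powr ?d * (indicator {0..} t * t powr ((1 - ?d) - 1) / exp t))"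
    for t
  proof (cases "t > 0")
    case True
    \<comment> \<open>The origin is cut out of the disc because \<open>0 powr (- \<alpha>)\<close>
      is \<open>0\<close>, so that no positive \<open>t\<close> satisfies the inequality at
      \<open>x = 0\<close>.\<close>
    have iff: "t \<le> a * norm x powr (- \<alpha>) \<longleftrightarrow> x \<in> cball 0 ((a / t) powr (1 / \<alpha>)) - {0}" for x :: "real^2"
    proof (cases "x = 0")
      case False
      have "t \<le> a * norm x powr (- \<alpha>) \<longleftrightarrow> norm x powr \<alpha> \<le> a / t"
        using True False by (simp add: powr_minus field_simps)
      also have "\<dots> \<longleftrightarrow> (norm x powr \<alpha>) powr (1 / \<alpha>) \<le> (a / t) powr (1 / \<alpha>)"
        using True a \<alpha> powr_mono2[of "1 / \<alpha>" "norm x powr \<alpha>" "a / t"]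
          powr_less_mono2[of "1 / \<alpha>" "a / t" "norm x powr \<alpha>"]
        by (auto simp: not_le[symmetric])
      also have "(norm x powr \<alpha>) powr (1 / \<alpha>) = norm x"
        using \<alpha> False by (simp add: powr_powr)
      finally show ?thesis
        using False by simp
    qed (use True in auto)
    have "(\<integral>\<^sup>+x. ?f x t \<partial>lborel)
        = (\<integral>\<^sup>+x. ennreal (exp (- t)) * indicator (cball 0 ((a / t) powr (1 / \<alpha>)) - {0}) (x::real^2) \<partial>lborel)"
      using True by (intro nn_integral_cong) (auto simp: iff indicator_def)
    also have "\<dots> = ennreal (exp (- t)) * emeasure lborel (cball (0::real^2) ((a / t) powr (1 / \<alpha>)) - {0})"
      by (intro nn_integral_cmult_indicator) auto
    also have "emeasure lborel (cball (0::real^2) ((a / t) powr (1 / \<alpha>)) - {0})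
        = emeasure lborel (cball (0::real^2) ((a / t) powr (1 / \<alpha>)))"
      by (intro emeasure_Diff_null_set) auto
    also have "\<dots> = ennreal (pi * ((a / t) powr (1 / \<alpha>)) ^ 2)"
      by (subst emeasure_cball) (auto simp: unit_ball_vol_2)
    also have "((a / t) powr (1 / \<alpha>)) ^ 2 = (a / t) powr ?d"
      using True by (cases "a = 0") (simp_all add: powr_power)
    also have "\<dots> = a powr ?d * t powr - ?d"
      using True a by (simp add: powr_divide powr_minus field_simps)

    finally show ?thesis
      using True by (simp add: ennreal_mult'[symmetric] exp_minus field_simps)
  qed (simp add: indicator_def)
  have "(\<integral>\<^sup>+x. ennreal (1 - exp (- (a * norm (x::real^2) powr (- \<alpha>)))) \<partial>lborel)
      = (\<integral>\<^sup>+x. \<integral>\<^sup>+t. ?f x t \<partial>lborel \<partial>lborel)"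
    using a by (intro nn_integral_cong nn_integral_exp_interval[symmetric]) auto
  also have "\<dots> = (\<integral>\<^sup>+t. \<integral>\<^sup>+x. ?f x t \<partial>lborel \<partial>lborel)"
  proof (rule lborel_pair.Fubini')
    have "Measurable.pred (lborel \<Otimes>\<^sub>M lborel)
      (\<lambda>p. 0 < fst p \<and> fst p \<le> a * norm (snd p :: real^2) powr (- \<alpha>))"
      by measurable
    then show "(\<lambda>(t, x). ?f x t) \<in> borel_measurable (lborel \<Otimes>\<^sub>M lborel)"
      unfolding indicator_def by (simp add: case_prod_beta)
  qed
  also have "\<dots> = (\<integral>\<^sup>+t. ennreal (pi * a powr ?d) * ennreal (indicator {0..} t * t powr ((1 - ?d) - 1) / exp t) \<partial>lborel)"
    unfolding area by (intro nn_integral_cong) (simp add: mult_ac flip: ennreal_mult')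
  also have "\<dots> = ennreal (pi * a powr ?d) * ennreal (Gamma (1 - ?d))"
    using \<alpha> by (subst nn_integral_cmult) (auto simp: Gamma_conv_nn_integral_real)
  also have "\<dots> = ennreal (pi * a powr ?d * Gamma (1 - ?d))"
    using a by (simp add: ennreal_mult')
  finally show ?thesis .
qed

section \<open>Gamma densities: tilted moments and integer shapes\<close>

lemma gamma_density_nonneg: "v > 0 \<Longrightarrow> 0 \<le> gamma_density v t x"
  by (simp add: gamma_density_def)

lemma measurable_gamma_density[measurable]: "gamma_density v t \<in> borel_measurable borel"
  unfolding gamma_density_def[abs_def] by measurable

text \<open>The rate \<open>1 / t\<close> of the density and the tilt \<open>c\<close> add up to
  \<open>b\<close>, and scaling by \<open>b\<close> leaves a Gamma integral. Real \<open>q\<close>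
  and \<open>c = 0\<close> are allowed, since the formula serves both the fractional moment of a
  mark and the tilted integer moments of \<open>Y\<close>.\<close>

lemma nn_integral_gamma_powr_exp:
  assumes "v > 0" "t > 0" "v + q > 0" "c \<ge> 0"
  shows "(\<integral>\<^sup>+x. ennreal (gamma_density v t x) * ennreal (x powr q * exp (- c * x)) \<partial>lborel)
    = ennreal (Gamma (v + q) / (Gamma v * t powr v) * (c + 1 / t) powr (- q - v))"
proof -
  define b where "b = c + 1 / t"
  have b: "b > 0"
    using assms unfolding b_def by (intro add_nonneg_pos) auto
  let ?g = "\<lambda>x. ennreal (indicator {0..} x * x powr (v + q - 1) / exp x)"
  have "ennreal (gamma_density v t x) * ennreal (x powr q * exp (- c * x))
      = ennreal (b powr (1 - q - v) / (Gamma v * t powr v)) * ?g (b * x)" if "x \<noteq> 0" for x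
  proof (cases "x > 0")
    case True
    have "gamma_density v t x * (x powr q * exp (- c * x))
        = x powr (v - 1 + q) * (exp (- x / t) * exp (- c * x)) / (Gamma v * t powr v)"
      using True by (simp add: gamma_density_def powr_add)
    also have "exp (- x / t) * exp (- c * x) = inverse (exp (b * x))"
      by (simp add: b_def algebra_simps flip: exp_add exp_minus)
    also have "x powr (v - 1 + q) = b powr (1 - q - v) * (b * x) powr (v + q - 1)"
      using True b by (simp add: powr_mult algebra_simps flip: powr_add mult.assoc)
    finally show ?thesis
      using True b assms by (simp add: ennreal_mult'[symmetric] gamma_density_nonneg field_simps)
  qed (use that b in \<open>auto simp: gamma_density_def indicator_def mult_le_0_iff zero_le_mult_iff\<close>)
  then have "(\<integral>\<^sup>+x. ennreal (gamma_density v t x) * ennreal (x powr q * exp (- c * x)) \<partial>lborel)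
      = (\<integral>\<^sup>+x. ennreal (b powr (1 - q - v) / (Gamma v * t powr v)) * ?g (b * x) \<partial>lborel)"
    using AE_lborel_singleton[of "0::real"]
    by (intro nn_integral_cong_AE) (auto elim!: eventually_mono)
  also have "\<dots> = ennreal (b powr (1 - q - v) / (Gamma v * t powr v)) * (\<integral>\<^sup>+x. ?g (b * x) \<partial>lborel)"
    by (intro nn_integral_cmult) auto
  also have "ennreal (Gamma (v + q)) = ennreal b * (\<integral>\<^sup>+x. ?g (b * x) \<partial>lborel)"
    using b assms(3) nn_integral_real_affine[of ?g b 0] by (simp add: Gamma_conv_nn_integral_real)
  then have "(\<integral>\<^sup>+x. ?g (b * x) \<partial>lborel) = ennreal (1 / b) * ennreal (Gamma (v + q))"
    using b by (simp add: mult.assoc[symmetric] ennreal_mult'[symmetric])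
  finally show ?thesis
    using b assms by (simp add: ennreal_mult'[symmetric] b_def[symmetric] powr_diff powr_minus powr_add field_simps)
qed

text \<open>The point \<open>0\<close> has to be left out: for \<open>k = 0\<close> the left side
  contains \<open>0 powr 0\<close>, which is \<open>0\<close>, while the Erlang density there is
  \<open>1 / t\<close>. Being a null set, it does not affect the law of \<open>W\<close>.\<close>

lemma gamma_density_Suc_eq_erlang_density:
  assumes "x \<noteq> 0" "t > 0"
  shows "gamma_density (real (Suc k)) t x = erlang_density k (1 / t) x"
proof -
  have "Gamma (real (Suc k)) = fact k" "t powr real (Suc k) = t ^ Suc k"
    using Gamma_fact[of k, where 'a = real] powr_realpow[of t "Suc k"] assms by simp_all
  moreover have "x powr (real (Suc k) - 1) = x ^ k" if "x > 0"
    using that by (simp add: powr_realpow)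
  ultimately show ?thesis
    using assms by (simp add: gamma_density_def erlang_density_def power_divide)
qed

subsection \<open>The Laplace transform of the interference\<close>

context prob_space
begin

text \<open>Where the series diverges, the limit of the exponentials is \<open>0\<close>; so the probability of
  summability is at least \<open>L s\<close> for every \<open>s > 0\<close>, and \<open>L s\<close> tends to \<open>1\<close> as \<open>s\<close> tends to \<open>0\<close>.\<close>

lemma
  fixes Z :: "nat \<Rightarrow> 'a \<Rightarrow> real"
  assumes Z[measurable]: "\<And>l. Z l \<in> borel_measurable M"
    and nonneg: "AE \<omega> in M. \<forall>l. 0 \<le> Z l \<omega>"
    and L: "\<And>s. s > 0 \<Longrightarrow> (\<integral>\<^sup>+\<omega>. (INF N. ennreal (exp (- (s * (\<Sum>l<N. Z l \<omega>))))) \<partial>M) = ennreal (L s)"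
    and L0: "(L \<longlongrightarrow> 1) (at_right 0)"
  shows AE_summable_of_Laplace: "AE \<omega> in M. summable (\<lambda>l. Z l \<omega>)"
    and expectation_exp_suminf: "s > 0 \<Longrightarrow> expectation (\<lambda>\<omega>. exp (- (s * (\<Sum>l. Z l \<omega>)))) = max 0 (L s)"
proof -
  have summ: "(INF N. ennreal (exp (- (s * (\<Sum>l<N. Z l \<omega>))))) = ennreal (exp (- (s * (\<Sum>l. Z l \<omega>))))"
    if "s > 0" "\<forall>l. 0 \<le> Z l \<omega>" "summable (\<lambda>l. Z l \<omega>)" for s \<omega>
  proof -
    have dec: "decseq (\<lambda>N. ennreal (exp (- (s * (\<Sum>l<N. Z l \<omega>)))))"
      using that by (intro decseq_SucI ennreal_leI) simp
    have lim: "(\<lambda>N. ennreal (exp (- (s * (\<Sum>l<N. Z l \<omega>))))) \<longlonglongrightarrow> ennreal (exp (- (s * (\<Sum>l. Z l \<omega>))))"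
      using that by (intro tendsto_ennrealI tendsto_exp tendsto_minus tendsto_mult_left summable_LIMSEQ)
    from LIMSEQ_INF[OF dec] lim show ?thesis
      by (rule LIMSEQ_unique)
  qed
  have not_summ: "(INF N. ennreal (exp (- (s * (\<Sum>l<N. Z l \<omega>))))) = 0"
    if "s > 0" "\<forall>l. 0 \<le> Z l \<omega>" "\<not> summable (\<lambda>l. Z l \<omega>)" for s \<omega>
  proof (rule ccontr)
    assume *: "(INF N. ennreal (exp (- (s * (\<Sum>l<N. Z l \<omega>))))) \<noteq> 0"
    have "(INF N. ennreal (exp (- (s * (\<Sum>l<N. Z l \<omega>))))) \<le> 1"
      by (rule INF_lower2[of 0]) auto
    with * obtain r where r: "(INF N. ennreal (exp (- (s * (\<Sum>l<N. Z l \<omega>))))) = ennreal r" "r > 0"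
      by (cases "INF N. ennreal (exp (- (s * (\<Sum>l<N. Z l \<omega>))))" rule: ennreal_cases)
        (auto simp: top_unique less_le)

    \<comment> \<open>A positive lower bound \<open>r\<close> of the exponentials bounds every
      partial sum, and a nonnegative series with bounded partial sums converges.\<close>
    have "(\<Sum>l<N. Z l \<omega>) \<le> - ln r / s" for N
    proof -
      have "ennreal r \<le> ennreal (exp (- (s * (\<Sum>l<N. Z l \<omega>))))"
        unfolding r(1)[symmetric] by (rule INF_lower) simp
      then have "exp (ln r) \<le> exp (- (s * (\<Sum>l<N. Z l \<omega>)))"
        using r(2) by simp
      then have "ln r \<le> - (s * (\<Sum>l<N. Z l \<omega>))"
        by (simp only: exp_le_cancel_iff)
      then show ?thesis
        using that(1) by (simp add: field_simps)
    qed
    then have "summable (\<lambda>l. Z l \<omega>)"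
      using that(2)
      by (intro bounded_imp_summable[where B = "- ln r / s"]) (simp_all only: lessThan_Suc_atMost[symmetric])
    then show False
      using that(3) by simp
  qed
  have [measurable]: "{\<omega> \<in> space M. summable (\<lambda>l. Z l \<omega>)} \<in> events"
    unfolding summable_iff_convergent Cauchy_convergent_iff[symmetric] by measurable
  have le: "L s \<le> prob {\<omega> \<in> space M. summable (\<lambda>l. Z l \<omega>)}" if "s > 0" for s
  proof -
    have "ennreal (L s) \<le> (\<integral>\<^sup>+\<omega>. indicator {\<omega> \<in> space M. summable (\<lambda>l. Z l \<omega>)} \<omega> \<partial>M)"
      unfolding L[OF that, symmetric] using nonneg AE_space[of M]
    proof (intro nn_integral_mono_AE, eventually_elim)
      case (elim \<omega>)
      have "(INF N. ennreal (exp (- (s * (\<Sum>l<N. Z l \<omega>))))) \<le> 1"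
        by (rule INF_lower2[of 0]) auto
      then show ?case
        using elim not_summ[OF that, of \<omega>] by (auto simp: indicator_def)
    qed
    then show ?thesis
      by (simp add: emeasure_eq_measure)
  qed
  have "1 \<le> prob {\<omega> \<in> space M. summable (\<lambda>l. Z l \<omega>)}"
    by (rule tendsto_upperbound[OF L0]) (auto simp: eventually_at_filter le)
  then have "prob {\<omega> \<in> space M. summable (\<lambda>l. Z l \<omega>)} = 1"
    using prob_le_1 antisym by blast
  then show summable: "AE \<omega> in M. summable (\<lambda>l. Z l \<omega>)"
    by (auto dest!: AE_prob_1)
  assume "s > 0"
  have "(\<integral>\<^sup>+\<omega>. ennreal (exp (- (s * (\<Sum>l. Z l \<omega>)))) \<partial>M) = ennreal (L s)"
    unfolding L[OF \<open>s > 0\<close>, symmetric] using summable nonneg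
    by (intro nn_integral_cong_AE) (auto elim!: eventually_elim2 simp: summ[OF \<open>s > 0\<close>])
  \<comment> \<open>\<open>L s\<close> is known only through \<open>ennreal\<close>, which sends
    negative reals to \<open>0\<close>; hence the maximum.\<close>
  then show "expectation (\<lambda>\<omega>. exp (- (s * (\<Sum>l. Z l \<omega>)))) = max 0 (L s)"
    by (subst integral_eq_nn_integral) (auto simp: max_def ennreal_neg)
qed

text \<open>By the product law the points may be frozen. For fixed points the \<open>N\<close>
  factors depend on different independent marks, so the mean of their product is the product of the
  means \<open>\<phi>\<close>. Nothing is asked of the joint law of the points.\<close>

lemma nn_integral_marked_point_prod:
  fixes X :: "nat \<Rightarrow> 'a \<Rightarrow> 'b::euclidean_space" and \<Psi> :: "nat \<Rightarrow> 'a \<Rightarrow> real"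
  assumes prod: "distr M ((\<Pi>\<^sub>M l\<in>UNIV. borel) \<Otimes>\<^sub>M (\<Pi>\<^sub>M l\<in>UNIV. borel)) (\<lambda>\<omega>. (\<lambda>l. X l \<omega>, \<lambda>l. \<Psi> l \<omega>))
      = distr M (\<Pi>\<^sub>M l\<in>UNIV. borel) (\<lambda>\<omega> l. X l \<omega>) \<Otimes>\<^sub>M distr M (\<Pi>\<^sub>M l\<in>UNIV. borel) (\<lambda>\<omega> l. \<Psi> l \<omega>)"
    and [measurable]: "\<And>l. X l \<in> borel_measurable M"
    and \<Psi>: "indep_vars (\<lambda>_. borel) \<Psi> UNIV"
    and h: "(\<lambda>p. h (fst p) (snd p)) \<in> borel_measurable (borel \<Otimes>\<^sub>M borel)"
    and \<phi>: "\<And>l x. (\<integral>\<^sup>+\<omega>. h x (\<Psi> l \<omega>) \<partial>M) = \<phi> x"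
  shows "(\<integral>\<^sup>+\<omega>. (\<Prod>l<N. h (X l \<omega>) (\<Psi> l \<omega>)) \<partial>M) = (\<integral>\<^sup>+\<omega>. (\<Prod>l<N. \<phi> (X l \<omega>)) \<partial>M)"
proof -
  have [measurable]: "\<Psi> l \<in> borel_measurable M" for l
    using \<Psi> by (simp add: indep_vars_def)
  let ?PX = "\<Pi>\<^sub>M l\<in>(UNIV::nat set). (borel :: 'b measure)"
  let ?P\<Psi> = "\<Pi>\<^sub>M l\<in>(UNIV::nat set). (borel :: real measure)"
  have [measurable]: "(\<lambda>\<omega> l. X l \<omega>) \<in> measurable M ?PX" "(\<lambda>\<omega> l. \<Psi> l \<omega>) \<in> measurable M ?P\<Psi>"
    by (rule measurable_PiM_single'; auto)+
  interpret P: prob_space "distr M ?P\<Psi> (\<lambda>\<omega> l. \<Psi> l \<omega>)"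
    by (rule prob_space_distr) simp
  let ?f = "\<lambda>(x, \<psi>). \<Prod>l<N. h (x l) (\<psi> l)"
  have h_meas: "(\<lambda>y. h (a y) (b y)) \<in> borel_measurable K"
    if "a \<in> borel_measurable K" "b \<in> borel_measurable K" for a b and K :: "((nat \<Rightarrow> 'b) \<times> (nat \<Rightarrow> real)) measure"
    using measurable_compose[OF measurable_Pair[OF that] h] by simp
  have h_meas2: "(\<lambda>y. h x y) \<in> borel_measurable borel" for x
    using measurable_compose[OF measurable_Pair[OF measurable_const measurable_ident] h] by simp

  have f[measurable]: "?f \<in> borel_measurable (?PX \<Otimes>\<^sub>M ?P\<Psi>)"
    unfolding split_beta by (intro borel_measurable_prod_ennreal h_meas) auto
  have "(\<integral>\<^sup>+\<omega>. (\<Prod>l<N. h (X l \<omega>) (\<Psi> l \<omega>)) \<partial>M)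
      = (\<integral>\<^sup>+p. ?f p \<partial>distr M (?PX \<Otimes>\<^sub>M ?P\<Psi>) (\<lambda>\<omega>. (\<lambda>l. X l \<omega>, \<lambda>l. \<Psi> l \<omega>)))"
    by (subst nn_integral_distr) auto
  also have "\<dots> = (\<integral>\<^sup>+x. \<integral>\<^sup>+\<psi>. ?f (x, \<psi>) \<partial>distr M ?P\<Psi> (\<lambda>\<omega> l. \<Psi> l \<omega>) \<partial>distr M ?PX (\<lambda>\<omega> l. X l \<omega>))"
    unfolding prod by (rule P.nn_integral_fst[symmetric]) simp
  also have "\<dots> = (\<integral>\<^sup>+x. (\<Prod>l<N. \<phi> (x l)) \<partial>distr M ?PX (\<lambda>\<omega> l. X l \<omega>))"
  proof (rule nn_integral_cong)
    fix x
    have "(\<integral>\<^sup>+\<psi>. ?f (x, \<psi>) \<partial>distr M ?P\<Psi> (\<lambda>\<omega> l. \<Psi> l \<omega>)) = (\<integral>\<^sup>+\<omega>. (\<Prod>l<N. h (x l) (\<Psi> l \<omega>)) \<partial>M)"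
    proof (subst nn_integral_distr)
      show "(\<lambda>\<psi>. ?f (x, \<psi>)) \<in> borel_measurable (distr M ?P\<Psi> (\<lambda>\<omega> l. \<Psi> l \<omega>))"
        by simp (intro borel_measurable_prod_ennreal measurable_compose[OF _ h_meas2], auto)
    qed auto
    also have "\<dots> = (\<Prod>l<N. \<integral>\<^sup>+\<omega>. h (x l) (\<Psi> l \<omega>) \<partial>M)"
    proof (rule indep_vars_nn_integral)
      show "indep_vars (\<lambda>_. borel) (\<lambda>l \<omega>. h (x l) (\<Psi> l \<omega>)) {..<N}"
        by (rule indep_vars_compose2[OF indep_vars_subset[OF \<Psi>]]) (auto intro: h_meas2)
    qed auto
    finally show "(\<integral>\<^sup>+\<psi>. ?f (x, \<psi>) \<partial>distr M ?P\<Psi> (\<lambda>\<omega> l. \<Psi> l \<omega>)) = (\<Prod>l<N. \<phi> (x l))"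
      by (simp add: \<phi>)
  qed
  also have "\<dots> = (\<integral>\<^sup>+\<omega>. (\<Prod>l<N. \<phi> (X l \<omega>)) \<partial>M)"
  proof -
    have "(\<lambda>x. \<integral>\<^sup>+\<omega>. h x (\<Psi> 0 \<omega>) \<partial>M) \<in> borel_measurable borel"
    proof (rule borel_measurable_nn_integral)
      have "(\<lambda>p. (fst p, \<Psi> 0 (snd p))) \<in> borel \<Otimes>\<^sub>M M \<rightarrow>\<^sub>M borel \<Otimes>\<^sub>M borel"
        by measurable
      from measurable_compose[OF this h]
      show "(\<lambda>(x, \<omega>). h x (\<Psi> 0 \<omega>)) \<in> borel_measurable (borel \<Otimes>\<^sub>M M)"
        by (simp add: split_beta)
    qed
    then have [measurable]: "\<phi> \<in> borel_measurable borel"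
      by (simp add: \<phi>)
    show ?thesis
      by (subst nn_integral_distr) auto
  qed
  finally show ?thesis .
qed

end

lemma (in prob_space) AE_gamma_nonneg:
  assumes "distributed M lborel Z (gamma_density v t)"
  shows "AE \<omega> in M. 0 \<le> Z \<omega>"
proof (rule AE_I)
  have [measurable]: "Z \<in> borel_measurable M"
    using distributed_measurable[OF assms] by simp
  show "{\<omega> \<in> space M. \<not> 0 \<le> Z \<omega>} \<subseteq> Z -` {..<0} \<inter> space M"
    by auto
  show "emeasure M (Z -` {..<0} \<inter> space M) = 0"
    by (subst distributed_emeasure[OF assms]) (auto simp: gamma_density_def nn_integral_0_iff_AE indicator_def)
qed (use distributed_measurable[OF assms] in auto)

section \<open>The interference of a Poisson process with gamma marks\<close>

context prob_space
begin

context
  fixes X :: "nat \<Rightarrow> 'a \<Rightarrow> real^2" and \<Psi> :: "nat \<Rightarrow> 'a \<Rightarrow> real" and \<alpha> c n \<Omega> :: real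
  assumes \<alpha>: "\<alpha> > 2" and c: "c \<ge> 0" and n: "n > 0" and \<Omega>: "\<Omega> > 0"
    and X: "homogeneous_PPP M c X"
    and \<Psi>: "\<And>l. distributed M lborel (\<Psi> l) (gamma_density n \<Omega>)"
    and \<Psi>_indep: "indep_vars (\<lambda>_. borel) \<Psi> UNIV"
    and prod: "distr M ((\<Pi>\<^sub>M l\<in>UNIV. borel) \<Otimes>\<^sub>M (\<Pi>\<^sub>M l\<in>UNIV. borel)) (\<lambda>\<omega>. (\<lambda>l. X l \<omega>, \<lambda>l. \<Psi> l \<omega>))
      = distr M (\<Pi>\<^sub>M l\<in>UNIV. borel) (\<lambda>\<omega> l. X l \<omega>) \<Otimes>\<^sub>M distr M (\<Pi>\<^sub>M l\<in>UNIV. borel) (\<lambda>\<omega> l. \<Psi> l \<omega>)"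
begin

text \<open>The mean factor contributed by a point at \<open>x\<close>: the Laplace transform of one
  weighted mark. \<open>enn2real\<close> makes it a real function, as the generating functional
  requires; for \<open>s > 0\<close> the integral is finite and nothing is lost.\<close>

private definition "F s x = enn2real (\<integral>\<^sup>+t. ennreal (gamma_density n \<Omega> t) * ennreal (exp (- (s * (norm x powr (- \<alpha>) * t)))) \<partial>lborel)"
  for s :: real and x :: "real^2"

text \<open>\<open>pi * Gamma (1 - 2 / \<alpha>)\<close> comes from the integral over the plane; the
  remaining factor is the moment of order \<open>2 / \<alpha>\<close> of a mark.\<close>

private definition "\<kappa> = pi * \<Omega> powr (2 / \<alpha>) * Gamma (n + 2 / \<alpha>) * Gamma (1 - 2 / \<alpha>) / Gamma n"

private lemma mark_density_total: "(\<integral>\<^sup>+t. ennreal (gamma_density n \<Omega> t) \<partial>lborel) = 1"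
  using distributed_nn_integral[OF \<Psi>[of 0], of "\<lambda>_. 1"] by (simp add: emeasure_space_1)

private lemma mark_density_nonneg: "0 \<le> gamma_density n \<Omega> t"
  using n by (rule gamma_density_nonneg)

private lemma mark_density_neg: "t < 0 \<Longrightarrow> gamma_density n \<Omega> t = 0"
  by (simp add: gamma_density_def)

private lemma F_measurable[measurable]: "F s \<in> borel_measurable borel"
  unfolding F_def[abs_def] by measurable

text \<open>Writing \<open>1 - F\<close> as the integral of a nonnegative function lets Tonelli
  exchange it with the integral over the plane. For \<open>t < 0\<close>, where
  \<open>1 - exp\<close> may be negative and \<open>ennreal\<close> would cut it off, the density
  vanishes.\<close>

private lemma
  assumes s: "s > 0"
  shows F_ennreal: "(\<integral>\<^sup>+t. ennreal (gamma_density n \<Omega> t) * ennreal (exp (- (s * (norm x powr (- \<alpha>) * t)))) \<partial>lborel) = ennreal (F s x)"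
    and F_le_1: "F s x \<le> 1"
    and one_minus_F: "ennreal (1 - F s x)
      = (\<integral>\<^sup>+t. ennreal (gamma_density n \<Omega> t) * ennreal (1 - exp (- (s * (norm x powr (- \<alpha>) * t)))) \<partial>lborel)"
proof -
  let ?\<phi> = "\<integral>\<^sup>+t. ennreal (gamma_density n \<Omega> t) * ennreal (exp (- (s * (norm x powr (- \<alpha>) * t)))) \<partial>lborel"
  let ?\<chi> = "\<integral>\<^sup>+t. ennreal (gamma_density n \<Omega> t) * ennreal (1 - exp (- (s * (norm x powr (- \<alpha>) * t)))) \<partial>lborel"
  have "?\<phi> + ?\<chi> = (\<integral>\<^sup>+t. ennreal (gamma_density n \<Omega> t) * ennreal (exp (- (s * (norm x powr (- \<alpha>) * t))))
      + ennreal (gamma_density n \<Omega> t) * ennreal (1 - exp (- (s * (norm x powr (- \<alpha>) * t)))) \<partial>lborel)"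
    by (subst nn_integral_add) auto
  also have "\<dots> = (\<integral>\<^sup>+t. ennreal (gamma_density n \<Omega> t) \<partial>lborel)"
  proof (rule nn_integral_cong)
    fix t
    show "ennreal (gamma_density n \<Omega> t) * ennreal (exp (- (s * (norm x powr (- \<alpha>) * t))))
      + ennreal (gamma_density n \<Omega> t) * ennreal (1 - exp (- (s * (norm x powr (- \<alpha>) * t)))) = ennreal (gamma_density n \<Omega> t)"
    proof (cases "t < 0")
      case False
      then show ?thesis
        using s by (simp add: distrib_left[symmetric] flip: ennreal_plus)
    qed (simp add: mark_density_neg)
  qed
  finally have sum: "?\<phi> + ?\<chi> = 1"
    by (simp add: mark_density_total)
  have "?\<phi> \<le> 1"
    unfolding sum[symmetric] by (rule add_increasing2) auto
  then have "?\<phi> < top"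
    by (rule le_less_trans) simp
  then show eq: "?\<phi> = ennreal (F s x)"
    by (simp add: F_def)
  with \<open>?\<phi> \<le> 1\<close> show "F s x \<le> 1"
    by simp
  have "?\<chi> = 1 - ?\<phi>"
    using \<open>?\<phi> < top\<close> ennreal_add_diff_cancel_left[of ?\<phi> ?\<chi>] unfolding sum by simp

  then show "ennreal (1 - F s x) = ?\<chi>"
    unfolding eq by (simp add: ennreal_minus F_def flip: ennreal_1)
qed

private lemma F_nonneg: "0 \<le> F s x"
  by (simp add: F_def)

text \<open>After exchanging the integrals, the plane integral at mark \<open>t\<close> is a
  multiple of \<open>(s * t) powr (2 / \<alpha>)\<close>, so what remains is a fractional moment of
  the gamma law.\<close>

private lemma has_integral_one_minus_F:
  assumes s: "s > 0"
  shows "has_bochner_integral lborel (\<lambda>x. 1 - F s x) (\<kappa> * s powr (2 / \<alpha>))"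
proof (rule has_bochner_integral_nn_integral)
  let ?d = "2 / \<alpha>"
  have d: "?d > 0" "1 - ?d > 0" "n + ?d > 0"
    using \<alpha> n by (auto intro: add_pos_pos)
  show "0 \<le> \<kappa> * s powr ?d"
    using d n by (auto simp: \<kappa>_def intro!: mult_nonneg_nonneg divide_nonneg_nonneg)
  have "(\<integral>\<^sup>+x. ennreal (1 - F s x) \<partial>lborel)
      = (\<integral>\<^sup>+t. \<integral>\<^sup>+x. ennreal (gamma_density n \<Omega> t) * ennreal (1 - exp (- (s * (norm (x::real^2) powr (- \<alpha>) * t)))) \<partial>lborel \<partial>lborel)"
    unfolding one_minus_F[OF s] by (rule lborel_pair.Fubini') measurable
  \<comment> \<open>The factor \<open>exp (- 0 * t)\<close> fits the integrand to
    \<open>nn_integral_gamma_powr_exp\<close> with \<open>c = 0\<close>.\<close>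
  also have "\<dots> = (\<integral>\<^sup>+t. ennreal (pi * s powr ?d * Gamma (1 - ?d)) * (ennreal (gamma_density n \<Omega> t) * ennreal (t powr ?d * exp (- 0 * t))) \<partial>lborel)"
  proof (rule nn_integral_cong)
    fix t
    show "(\<integral>\<^sup>+x. ennreal (gamma_density n \<Omega> t) * ennreal (1 - exp (- (s * (norm (x::real^2) powr (- \<alpha>) * t)))) \<partial>lborel)
      = ennreal (pi * s powr ?d * Gamma (1 - ?d)) * (ennreal (gamma_density n \<Omega> t) * ennreal (t powr ?d * exp (- 0 * t)))"
    proof (cases "t < 0")
      case False
      have "(\<integral>\<^sup>+x. ennreal (gamma_density n \<Omega> t) * ennreal (1 - exp (- (s * (norm (x::real^2) powr (- \<alpha>) * t)))) \<partial>lborel)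
          = ennreal (gamma_density n \<Omega> t) * (\<integral>\<^sup>+x. ennreal (1 - exp (- ((s * t) * norm (x::real^2) powr (- \<alpha>)))) \<partial>lborel)"
        by (subst nn_integral_cmult[symmetric]) (auto simp: mult_ac)
      also have "\<dots> = ennreal (gamma_density n \<Omega> t) * ennreal (pi * (s * t) powr ?d * Gamma (1 - ?d))"
        using s False \<alpha> by (subst nn_integral_one_minus_exp_norm_powr) auto
      finally show ?thesis
        using s False d by (simp add: powr_mult mark_density_nonneg mult_ac flip: ennreal_mult')
    qed (simp add: mark_density_neg)
  qed
  also have "\<dots> = ennreal (pi * s powr ?d * Gamma (1 - ?d))
      * (\<integral>\<^sup>+t. ennreal (gamma_density n \<Omega> t) * ennreal (t powr ?d * exp (- 0 * t)) \<partial>lborel)"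
    by (intro nn_integral_cmult) measurable
  also have "(\<integral>\<^sup>+t. ennreal (gamma_density n \<Omega> t) * ennreal (t powr ?d * exp (- 0 * t)) \<partial>lborel)
      = ennreal (Gamma (n + ?d) / (Gamma n * \<Omega> powr n) * (0 + 1 / \<Omega>) powr (- ?d - n))"
    using n \<Omega> d by (intro nn_integral_gamma_powr_exp) auto
  also have "ennreal (pi * s powr ?d * Gamma (1 - ?d))
      * ennreal (Gamma (n + ?d) / (Gamma n * \<Omega> powr n) * (0 + 1 / \<Omega>) powr (- ?d - n))
    = ennreal (pi * s powr ?d * Gamma (1 - ?d)
      * (Gamma (n + ?d) / (Gamma n * \<Omega> powr n) * (1 / \<Omega>) powr (- ?d - n)))"
    unfolding add_0 using d by (intro ennreal_mult'[symmetric]) (auto intro!: mult_nonneg_nonneg)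

  also have "(1 / \<Omega>) powr (- ?d - n) = \<Omega> powr ?d * \<Omega> powr n"
    using \<Omega> by (simp add: powr_divide powr_minus powr_diff field_simps)
  also have "pi * s powr ?d * Gamma (1 - ?d) * (Gamma (n + ?d) / (Gamma n * \<Omega> powr n) * (\<Omega> powr ?d * \<Omega> powr n))
      = \<kappa> * s powr ?d"
    using \<Omega> by (simp add: \<kappa>_def)
  finally show "(\<integral>\<^sup>+x. ennreal (1 - F s x) \<partial>lborel) = ennreal (\<kappa> * s powr ?d)" .
qed (auto simp: F_le_1 s)

private lemma marks_nonneg: "AE \<omega> in M. \<forall>l. 0 \<le> norm (X l \<omega>) powr (- \<alpha>) * \<Psi> l \<omega>"
proof -
  have "AE \<omega> in M. \<forall>l. 0 \<le> \<Psi> l \<omega>"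
    unfolding AE_all_countable using AE_gamma_nonneg[OF \<Psi>] by blast
  then show ?thesis
    by eventually_elim auto
qed

text \<open>The infimum is pulled out of the expectation, the marks are averaged out of each finite
  product, and the infimum is pushed back in, now over products in the points alone. The first
  monotonicity holds only almost surely, as marks may be negative on a null set.\<close>

private lemma Laplace_partial_sums:
  assumes s: "s > 0"
  shows "(\<integral>\<^sup>+\<omega>. (INF N. ennreal (exp (- (s * (\<Sum>l<N. norm (X l \<omega>) powr (- \<alpha>) * \<Psi> l \<omega>))))) \<partial>M)
    = ennreal (exp (- (c * (\<kappa> * s powr (2 / \<alpha>)))))"
proof -
  have [measurable]: "X l \<in> borel_measurable M" "\<Psi> l \<in> borel_measurable M" for l
    using X distributed_measurable[OF \<Psi>[of l]] by (auto simp: homogeneous_PPP_def)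
  let ?h = "\<lambda>x t. ennreal (exp (- (s * (norm (x::real^2) powr (- \<alpha>) * t))))"
  have exp_eq: "ennreal (exp (- (s * (\<Sum>l<N. norm (X l \<omega>) powr (- \<alpha>) * \<Psi> l \<omega>))))
      = (\<Prod>l<N. ?h (X l \<omega>) (\<Psi> l \<omega>))" for N \<omega>
    by (simp add: prod_ennreal exp_sum[symmetric] sum_negf sum_distrib_left)
  have "(\<integral>\<^sup>+\<omega>. (INF N. \<Prod>l<N. ?h (X l \<omega>) (\<Psi> l \<omega>)) \<partial>M) = (INF N. \<integral>\<^sup>+\<omega>. (\<Prod>l<N. ?h (X l \<omega>) (\<Psi> l \<omega>)) \<partial>M)"
  proof (rule nn_integral_monotone_convergence_INF_AE)
    show "AE \<omega> in M. (\<Prod>l<Suc N. ?h (X l \<omega>) (\<Psi> l \<omega>)) \<le> (\<Prod>l<N. ?h (X l \<omega>) (\<Psi> l \<omega>))" for N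
      using marks_nonneg
    proof eventually_elim
      case (elim \<omega>)
      then have "?h (X N \<omega>) (\<Psi> N \<omega>) \<le> 1"
        using s by (simp add: ennreal_le_1)
      then show ?case
        using mult_left_mono[of "?h (X N \<omega>) (\<Psi> N \<omega>)" 1 "\<Prod>l<N. ?h (X l \<omega>) (\<Psi> l \<omega>)"] by simp
    qed
    show "(\<integral>\<^sup>+\<omega>. (\<Prod>l<0. ?h (X l \<omega>) (\<Psi> l \<omega>)) \<partial>M) < \<infinity>"
      by (simp add: emeasure_space_1)
  qed measurable
  also have "\<dots> = (INF N. \<integral>\<^sup>+\<omega>. (\<Prod>l<N. ennreal (F s (X l \<omega>))) \<partial>M)"
  proof (intro INF_cong refl nn_integral_marked_point_prod[OF prod _ \<Psi>_indep])
    show "(\<integral>\<^sup>+\<omega>. ?h x (\<Psi> l \<omega>) \<partial>M) = ennreal (F s x)" for l x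
      unfolding F_ennreal[OF s, symmetric] by (rule distributed_nn_integral[OF \<Psi>, symmetric]) measurable
  qed measurable
  also have "\<dots> = (\<integral>\<^sup>+\<omega>. point_prod X (F s) \<omega> \<partial>M)"
    unfolding point_prod_def
  proof (rule nn_integral_monotone_convergence_INF_AE[symmetric])
    show "AE \<omega> in M. (\<Prod>l<Suc N. ennreal (F s (X l \<omega>))) \<le> (\<Prod>l<N. ennreal (F s (X l \<omega>)))" for N
    proof (rule AE_I2)
      fix \<omega>
      have "ennreal (F s (X N \<omega>)) \<le> 1"
        using F_le_1[OF s] by (simp add: ennreal_le_1)
      then show "(\<Prod>l<Suc N. ennreal (F s (X l \<omega>))) \<le> (\<Prod>l<N. ennreal (F s (X l \<omega>)))"
        using mult_left_mono[of "ennreal (F s (X N \<omega>))" 1 "\<Prod>l<N. ennreal (F s (X l \<omega>))"] by simp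
    qed
    show "(\<integral>\<^sup>+\<omega>. (\<Prod>l<0. ennreal (F s (X l \<omega>))) \<partial>M) < \<infinity>"
      by (simp add: emeasure_space_1)
  qed measurable
  also have "\<dots> = ennreal (exp (- (c * (\<integral>x. 1 - F s x \<partial>lborel))))"
    using has_integral_one_minus_F[OF s]
    by (intro nn_integral_point_prod[OF X c] F_nonneg F_le_1 s) (auto simp: has_bochner_integral_iff)
  also have "(\<integral>x. 1 - F s x \<partial>lborel) = \<kappa> * s powr (2 / \<alpha>)"
    using has_integral_one_minus_F[OF s] by (rule has_bochner_integral_integral_eq)
  finally show ?thesis
    unfolding exp_eq .
qed

lemma
  shows AE_summable_interference: "AE \<omega> in M. summable (\<lambda>l. norm (X l \<omega>) powr (- \<alpha>) * \<Psi> l \<omega>)"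
    and AE_interference_nonneg: "AE \<omega> in M. 0 \<le> (\<Sum>l. norm (X l \<omega>) powr (- \<alpha>) * \<Psi> l \<omega>)"
    and Laplace_interference: "s > 0 \<Longrightarrow>
      expectation (\<lambda>\<omega>. exp (- (s * (\<Sum>l. norm (X l \<omega>) powr (- \<alpha>) * \<Psi> l \<omega>))))
        = exp (- (c * (pi * \<Omega> powr (2 / \<alpha>) * Gamma (n + 2 / \<alpha>) * Gamma (1 - 2 / \<alpha>) / Gamma n) * s powr (2 / \<alpha>)))"
proof -
  have [measurable]: "X l \<in> borel_measurable M" "\<Psi> l \<in> borel_measurable M" for l
    using X distributed_measurable[OF \<Psi>[of l]] by (auto simp: homogeneous_PPP_def)
  have "((\<lambda>s::real. s powr (2 / \<alpha>)) \<longlongrightarrow> 0) (at_right 0)"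
    using \<alpha> by (intro tendsto_zero_powrI[where b = "2 / \<alpha>"]) (auto simp: eventually_at_filter)
  then have "((\<lambda>s. exp (- (c * (\<kappa> * s powr (2 / \<alpha>))))) \<longlongrightarrow> exp (- (c * (\<kappa> * 0)))) (at_right 0)"
    by (intro tendsto_intros)
  then have L0: "((\<lambda>s. exp (- (c * (\<kappa> * s powr (2 / \<alpha>))))) \<longlongrightarrow> 1) (at_right 0)"
    by simp
  note * = marks_nonneg Laplace_partial_sums L0
  show summable: "AE \<omega> in M. summable (\<lambda>l. norm (X l \<omega>) powr (- \<alpha>) * \<Psi> l \<omega>)"
    by (rule AE_summable_of_Laplace[OF _ *]) measurable
  show "AE \<omega> in M. 0 \<le> (\<Sum>l. norm (X l \<omega>) powr (- \<alpha>) * \<Psi> l \<omega>)"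
    using summable marks_nonneg by eventually_elim (auto intro!: suminf_nonneg)
  assume "s > 0"
  then show "expectation (\<lambda>\<omega>. exp (- (s * (\<Sum>l. norm (X l \<omega>) powr (- \<alpha>) * \<Psi> l \<omega>))))
        = exp (- (c * (pi * \<Omega> powr (2 / \<alpha>) * Gamma (n + 2 / \<alpha>) * Gamma (1 - 2 / \<alpha>) / Gamma n) * s powr (2 / \<alpha>)))"
    by (subst expectation_exp_suminf[OF _ *]) (auto simp: max_def \<kappa>_def mult.assoc)
qed

end

end

subsection \<open>Exponentially tilted moments and Stirling numbers\<close>

text \<open>A single term of the exponential series is at most its sum. The bound makes all tilted
  moments finite without any moment of the variable itself, which matters because the interference
  has infinite mean: \<open>norm x powr (- \<alpha>)\<close> is not integrable near the origin of
  the plane.\<close>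

lemma power_mult_exp_le:
  fixes x z :: real
  assumes "x \<ge> 0" "z > 0"
  shows "x ^ k * exp (- (z * x)) \<le> fact k / z ^ k"
proof -
  have "(z * x) ^ k / fact k \<le> exp (z * x)"
    using assms sum_le_suminf[OF summable_exp_generic[of "z * x"], of "{k}"]
    by (simp add: exp_def scaleR_conv_of_real divide_inverse mult.commute)
  then have "(z * x) ^ k * exp (- (z * x)) \<le> fact k"
    by (simp add: field_simps exp_minus)
  then show ?thesis
    using assms by (simp add: power_mult_distrib field_simps)
qed

context prob_space
begin

context
  fixes Z :: "'a \<Rightarrow> real"
  assumes Z[measurable]: "Z \<in> borel_measurable M" and nonneg: "AE \<omega> in M. 0 \<le> Z \<omega>"
begin

lemma integrable_power_exp:
  assumes "z > 0"
  shows "integrable M (\<lambda>\<omega>. Z \<omega> ^ r * exp (- (z * Z \<omega>)))"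
proof (rule integrable_const_bound[where B = "fact r / z ^ r"])
  show "AE \<omega> in M. norm (Z \<omega> ^ r * exp (- (z * Z \<omega>))) \<le> fact r / z ^ r"
    using nonneg by eventually_elim (simp add: power_mult_exp_le assms)
qed measurable

text \<open>Differentiation under the expectation by a second-order expansion: for increments up to
  \<open>z / 2\<close> the error is at most \<open>h\<^sup>2\<close> times the moment of order
  \<open>r + 2\<close> at tilt \<open>z / 2\<close>, which is finite.\<close>

lemma has_derivative_expectation_power_exp:
  assumes z: "z > 0"
  shows "((\<lambda>z. expectation (\<lambda>\<omega>. Z \<omega> ^ r * exp (- (z * Z \<omega>)))) has_real_derivative
    - expectation (\<lambda>\<omega>. Z \<omega> ^ Suc r * exp (- (z * Z \<omega>)))) (at z)"
proof -
  define F where "F r z = expectation (\<lambda>\<omega>. Z \<omega> ^ r * exp (- (z * Z \<omega>)))" for r z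
  have pointwise: "\<bar>x ^ r * exp (- ((z + h) * x)) - x ^ r * exp (- (z * x)) + h * (x ^ Suc r * exp (- (z * x)))\<bar>
      \<le> h\<^sup>2 * (x ^ Suc (Suc r) * exp (- (z / 2 * x)))" if "x \<ge> 0" "\<bar>h\<bar> \<le> z / 2" for x h
  proof -
    obtain t where t: "\<bar>t\<bar> \<le> \<bar>- (h * x)\<bar>" "exp (- (h * x)) = (\<Sum>m<2. (- (h * x)) ^ m / fact m) + exp t / fact 2 * (- (h * x)) ^ 2"
      using Maclaurin_exp_le[of "- (h * x)" 2] by blast
    have "x ^ r * exp (- ((z + h) * x)) - x ^ r * exp (- (z * x)) + h * (x ^ Suc r * exp (- (z * x)))
        = x ^ r * exp (- (z * x)) * (exp (- (h * x)) - 1 + h * x)"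
      by (simp add: algebra_simps flip: exp_add)
    also have "exp (- (h * x)) - 1 + h * x = exp t / 2 * (h * x)\<^sup>2"
      unfolding t(2) by (simp add: eval_nat_numeral)
    also have "x ^ r * exp (- (z * x)) * (exp t / 2 * (h * x)\<^sup>2)
        = h\<^sup>2 * (x ^ Suc (Suc r) * (exp (- (z * x)) * exp t / 2))"
      by (simp add: power_mult_distrib power2_eq_square)
    finally have eq: "x ^ r * exp (- ((z + h) * x)) - x ^ r * exp (- (z * x)) + h * (x ^ Suc r * exp (- (z * x)))
        = h\<^sup>2 * (x ^ Suc (Suc r) * (exp (- (z * x)) * exp t / 2))" .
    \<comment> \<open>The remainder involves an unknown \<open>t\<close> no larger in modulus than
      \<open>h * x\<close>. Since \<open>h\<close> is at most \<open>z / 2\<close> in modulus, half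
      of the tilt absorbs \<open>exp t\<close>.\<close>
    have "t \<le> z / 2 * x"
      using t(1) mult_right_mono[OF that(2,1)] that(1) by (simp add: abs_mult)
    then have "exp (- (z * x) + t) \<le> exp (- (z / 2 * x))"
      by simp
    then have "exp (- (z * x)) * exp t / 2 \<le> exp (- (z / 2 * x))"
      unfolding exp_add using exp_gt_zero[of "- (z * x) + t"] exp_add[of "- (z * x)" t] by linarith
    then have "h\<^sup>2 * (x ^ Suc (Suc r) * (exp (- (z * x)) * exp t / 2)) \<le> h\<^sup>2 * (x ^ Suc (Suc r) * exp (- (z / 2 * x)))"
      using that(1) by (intro mult_left_mono) auto
    then show ?thesis
      unfolding eq using that(1) by (subst abs_of_nonneg) (auto simp del: power_Suc)
  qed
  have bound: "norm ((F r (z + h) - F r z) / h - - F (Suc r) z) \<le> \<bar>h\<bar> * F (Suc (Suc r)) (z / 2)"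
    if "\<bar>h\<bar> \<le> z / 2" "h \<noteq> 0" for h
  proof -
    have int: "integrable M (\<lambda>\<omega>. Z \<omega> ^ r * exp (- (y * Z \<omega>)))" if "y > 0" for r y
      by (rule integrable_power_exp[OF that])
    have pos: "z + h > 0" "z / 2 > 0"
      using that z by linarith+
    have "\<bar>F r (z + h) - F r z + h * F (Suc r) z\<bar>
        = \<bar>expectation (\<lambda>\<omega>. Z \<omega> ^ r * exp (- ((z + h) * Z \<omega>)) - Z \<omega> ^ r * exp (- (z * Z \<omega>))
            + h * (Z \<omega> ^ Suc r * exp (- (z * Z \<omega>))))\<bar>"
      unfolding F_def using int[OF pos(1)] int[OF z]
      by (subst Bochner_Integration.integral_add) (auto simp del: power_Suc)
    also have "\<dots> \<le> expectation (\<lambda>\<omega>. h\<^sup>2 * (Z \<omega> ^ Suc (Suc r) * exp (- (z / 2 * Z \<omega>))))"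
    proof (intro order_trans[OF integral_abs_bound] integral_mono_AE integrable_abs)
      show "AE \<omega> in M. \<bar>Z \<omega> ^ r * exp (- ((z + h) * Z \<omega>)) - Z \<omega> ^ r * exp (- (z * Z \<omega>))
            + h * (Z \<omega> ^ Suc r * exp (- (z * Z \<omega>)))\<bar> \<le> h\<^sup>2 * (Z \<omega> ^ Suc (Suc r) * exp (- (z / 2 * Z \<omega>)))"
        using nonneg by eventually_elim (rule pointwise[OF _ that(1)])
    qed (intro Bochner_Integration.integrable_add Bochner_Integration.integrable_diff
        integrable_mult_right int pos z)+
    also have "\<dots> = h\<^sup>2 * F (Suc (Suc r)) (z / 2)"
      by (simp add: F_def)
    finally have "\<bar>F r (z + h) - F r z + h * F (Suc r) z\<bar> / \<bar>h\<bar> \<le> h\<^sup>2 * F (Suc (Suc r)) (z / 2) / \<bar>h\<bar>"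
      by (rule divide_right_mono) simp
    moreover have "(F r (z + h) - F r z) / h - - F (Suc r) z = (F r (z + h) - F r z + h * F (Suc r) z) / h"
      using that(2) by (simp add: field_simps)
    moreover have "h\<^sup>2 * F (Suc (Suc r)) (z / 2) / \<bar>h\<bar> = \<bar>h\<bar> * F (Suc (Suc r)) (z / 2)"
      using that(2) by (simp add: power2_eq_square field_simps abs_if)
    ultimately show ?thesis
      by (simp add: abs_divide)
  qed
  have "((\<lambda>h. (F r (z + h) - F r z) / h - - F (Suc r) z) \<longlongrightarrow> 0) (at 0)"
  proof (rule Lim_null_comparison)
    show "\<forall>\<^sub>F h in at 0. norm ((F r (z + h) - F r z) / h - - F (Suc r) z) \<le> \<bar>h\<bar> * F (Suc (Suc r)) (z / 2)"
      unfolding eventually_at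
    proof (intro exI[of _ "z / 2"] conjI ballI impI)
      fix h :: real assume "h \<noteq> 0 \<and> dist h 0 < z / 2"
      then show "norm ((F r (z + h) - F r z) / h - - F (Suc r) z) \<le> \<bar>h\<bar> * F (Suc (Suc r)) (z / 2)"
        by (intro bound) (auto simp: dist_real_def)
    qed (use z in simp)
    have "((\<lambda>h. \<bar>h\<bar> * F (Suc (Suc r)) (z / 2)) \<longlongrightarrow> \<bar>0\<bar> * F (Suc (Suc r)) (z / 2)) (at 0)"
      by (intro tendsto_intros)
    then show "((\<lambda>h. \<bar>h\<bar> * F (Suc (Suc r)) (z / 2)) \<longlongrightarrow> 0) (at 0)"
      by simp
  qed
  then have "(F r has_real_derivative - F (Suc r) z) (at z)"
    unfolding DERIV_def by (rule LIM_zero_cancel)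
  then show ?thesis
    unfolding F_def .
qed

end

end

text \<open>By the Stirling recurrence the Touchard polynomials satisfy T_(i+1) = y (T_i' + T_i), so
  \<open>y d/dy\<close> raises the index. Describing only \<open>y * D\<close> avoids a division and
  stays valid at \<open>y = 0\<close>.\<close>

lemma Touchard_exp_has_derivative:
  fixes y :: real
  obtains D where
    "((\<lambda>y. (\<Sum>j = 0..i. real (Stirling i j) * y ^ j) * exp y) has_real_derivative D) (at y)"
    "y * D = (\<Sum>j = 0..Suc i. real (Stirling (Suc i) j) * y ^ j) * exp y"
proof
  let ?T = "\<lambda>i y. \<Sum>j = 0..i. real (Stirling i j) * y ^ j"
  let ?T' = "\<lambda>i y. \<Sum>j = 0..i. real (Stirling i j) * (real j * y ^ (j - 1))"
  show "((\<lambda>y. ?T i y * exp y) has_real_derivative (?T' i y * exp y + ?T i y * exp y)) (at y)"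
    by (auto intro!: derivative_eq_intros sum.cong)
  have pow: "real j * real (Stirling i j) * y ^ j = y * (real (Stirling i j) * (real j * y ^ (j - 1)))" for j
    by (cases j) auto
  have "?T (Suc i) y = (\<Sum>j = 0..i. real (Stirling (Suc i) (Suc j)) * y ^ Suc j)"
    by (subst sum.atLeast0_atMost_Suc_shift) simp
  also have "\<dots> = (\<Sum>j = 0..i. real (Suc j) * real (Stirling i (Suc j)) * y ^ Suc j)
      + (\<Sum>j = 0..i. real (Stirling i j) * y ^ Suc j)"
    by (simp add: sum.distrib[symmetric] algebra_simps)
  \<comment> \<open>After the index shift the new term \<open>j = 0\<close> has factor
    \<open>0\<close>; in the next step the term \<open>j = Suc i\<close> drops because
    \<open>Stirling i (Suc i)\<close> is \<open>0\<close>.\<close>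
  also have "(\<Sum>j = 0..i. real (Suc j) * real (Stirling i (Suc j)) * y ^ Suc j)
      = (\<Sum>j = 0..Suc i. real j * real (Stirling i j) * y ^ j)"
    by (subst sum.atLeast0_atMost_Suc_shift) simp
  also have "\<dots> = y * ?T' i y"
    by (simp add: pow sum_distrib_left del: mult_eq_0_iff)
  also have "(\<Sum>j = 0..i. real (Stirling i j) * y ^ Suc j) = y * ?T i y"
    by (simp add: sum_distrib_left mult_ac)
  finally show "y * (?T' i y * exp y + ?T i y * exp y) = ?T (Suc i) y * exp y"
    by (simp add: algebra_simps)
qed

text \<open>\<open>g i\<close> is the \<open>i\<close>-th iterate of \<open>z d/dz\<close> applied
  to \<open>exp (- C * z powr d)\<close>; dividing by \<open>z\<close> gives the plain
  derivative.\<close>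

lemma Touchard_powr_has_derivative:
  fixes z C d :: real
  assumes "z > 0"
  defines "g \<equiv> \<lambda>i z. d ^ i * ((\<Sum>j = 0..i. real (Stirling i j) * (- C * z powr d) ^ j)
    * exp (- C * z powr d))"
  shows "(g i has_real_derivative g (Suc i) z / z) (at z)"
proof -
  let ?y = "\<lambda>z. - C * z powr d"
  obtain D where D:
    "((\<lambda>y. (\<Sum>j = 0..i. real (Stirling i j) * y ^ j) * exp y) has_real_derivative D) (at (?y z))"
    "?y z * D = (\<Sum>j = 0..Suc i. real (Stirling (Suc i) j) * ?y z ^ j) * exp (?y z)"
    by (rule Touchard_exp_has_derivative)
  have y: "(?y has_real_derivative ?y z * d / z) (at z)"
    using assms by (auto intro!: derivative_eq_intros simp: powr_diff)
  have "(g i has_real_derivative d ^ i * (D * (?y z * d / z))) (at z)"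
    unfolding g_def by (intro DERIV_cmult DERIV_chain'[OF y D(1)])
  also have "d ^ i * (D * (?y z * d / z)) = d ^ Suc i * (?y z * D) / z"
    by simp
  finally show ?thesis
    unfolding D(2) g_def by simp
qed

text \<open>Compare coefficients when the falling factorial of degree \<open>q\<close> is multiplied
  by its next factor \<open>x - q\<close>.\<close>

lemma signed_stirling_Suc_Suc:
  "signed_stirling (Suc q) (Suc j) = signed_stirling q j - int q * signed_stirling q (Suc j)"
  by (simp add: signed_stirling_def algebra_simps)

text \<open>As functions of \<open>z\<close>, both sides \<open>G\<^sub>q\<close> satisfy \<open>G\<^sub>q\<^sub>+\<^sub>1 = z G\<^sub>q' - (q + 1) G\<^sub>q\<close>.\<close>

lemma stirling_Touchard_eq_moments:
  fixes F :: "nat \<Rightarrow> real \<Rightarrow> real" and C d z :: real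
  assumes F: "\<And>r z. z > 0 \<Longrightarrow> (F r has_real_derivative - F (Suc r) z) (at z)"
    and F0: "\<And>z. z > 0 \<Longrightarrow> F 0 z = exp (- C * z powr d)"
    and "z > 0"
  shows "(\<Sum>i = 0..q. real_of_int (signed_stirling (Suc q) (i + 1)) * d ^ i
      * (\<Sum>j = 0..i. real (Stirling i j) * (- C * z powr d) ^ j)) * exp (- C * z powr d)
    = (- 1) ^ q * fact q * (\<Sum>r\<le>q. z ^ r * F r z / fact r)"
proof -
  define g where "g = (\<lambda>i z. d ^ i * ((\<Sum>j = 0..i. real (Stirling i j) * (- C * z powr d) ^ j)
    * exp (- C * z powr d)))"
  \<comment> \<open>\<open>B q\<close> represents (D - 1) ... (D - q) applied to
    \<open>exp (- C * z powr d)\<close>, where D is \<open>z d/dz\<close>; \<open>R q\<close> is the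
    partial sum of tilted moments.\<close>
  define B where "B = (\<lambda>q z. \<Sum>i\<le>q. real_of_int (signed_stirling (Suc q) (Suc i)) * g i z)"
  define R where "R = (\<lambda>q z. \<Sum>r\<le>q. z ^ r * F r z / fact r)"
  have B_Suc: "B (Suc q) z = (\<Sum>i\<le>q. real_of_int (signed_stirling (Suc q) (Suc i)) * g (Suc i) z)
      - Suc q * B q z" for q z
  proof -
    have "B (Suc q) z = (\<Sum>i\<le>Suc q. real_of_int (signed_stirling (Suc q) i) * g i z)
      - (\<Sum>i\<le>Suc q. Suc q * (real_of_int (signed_stirling (Suc q) (Suc i)) * g i z))"
      unfolding B_def sum_subtractf[symmetric]
      by (intro sum.cong refl) (subst signed_stirling_Suc_Suc, simp add: algebra_simps)
    \<comment> \<open>The term \<open>i = 0\<close> vanishes because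
      \<open>signed_stirling (Suc q) 0\<close> is \<open>0\<close>. In the other sum the term
      \<open>i = Suc q\<close> vanishes, its second Stirling index exceeding the first.\<close>
    also have "(\<Sum>i\<le>Suc q. real_of_int (signed_stirling (Suc q) i) * g i z)
        = (\<Sum>i\<le>q. real_of_int (signed_stirling (Suc q) (Suc i)) * g (Suc i) z)"
      by (subst sum.atMost_Suc_shift) (simp add: signed_stirling_def)
    also have "(\<Sum>i\<le>Suc q. Suc q * (real_of_int (signed_stirling (Suc q) (Suc i)) * g i z))
        = Suc q * B q z"
      by (simp add: B_def sum_distrib_left signed_stirling_def)
    finally show ?thesis .
  qed
  have B': "(B q has_real_derivative (B (Suc q) z + Suc q * B q z) / z) (at z)" if "z > 0" for q z
  proof -
    have "(B q has_real_derivative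
        (\<Sum>i\<le>q. real_of_int (signed_stirling (Suc q) (Suc i)) * (g (Suc i) z / z))) (at z)"
      unfolding B_def
      by (intro DERIV_sum DERIV_cmult) (simp only: g_def Touchard_powr_has_derivative[OF that])
    then show ?thesis
      by (simp add: B_Suc sum_divide_distrib)
  qed
  \<comment> \<open>Telescoping: differentiating the power in term \<open>r + 1\<close> cancels
    differentiating \<open>F r\<close> in term \<open>r\<close>, so only the derivative of
    \<open>F q\<close> in the last term survives.\<close>
  have R': "(R q has_real_derivative - (z ^ q * F (Suc q) z / fact q)) (at z)" if "z > 0" for q z
  proof (induction q)
    case 0
    then show ?case
      using F[OF that, of 0] by (simp add: R_def)
  next
    case (Suc q)
    have "((\<lambda>z. R q z + z ^ Suc q * F (Suc q) z / fact (Suc q)) has_real_derivative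
        - (z ^ q * F (Suc q) z / fact q)
        + (real (Suc q) * z ^ q * F (Suc q) z + z ^ Suc q * (- F (Suc (Suc q)) z)) / fact (Suc q)) (at z)"
      by (intro DERIV_add Suc DERIV_cdivide)
        (use DERIV_mult[OF DERIV_pow[of "Suc q"] F[OF that, of "Suc q"]] in \<open>simp add: algebra_simps\<close>)

    moreover have "- (z ^ q * F (Suc q) z / fact q)
        + (real (Suc q) * z ^ q * F (Suc q) z + z ^ Suc q * (- F (Suc (Suc q)) z)) / fact (Suc q)
        = - (z ^ Suc q * F (Suc (Suc q)) z / fact (Suc q))"
      by (simp add: divide_simps del: of_nat_Suc)
    moreover have "R (Suc q) = (\<lambda>z. R q z + z ^ Suc q * F (Suc q) z / fact (Suc q))"
      by (simp add: R_def)
    ultimately show ?case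
      by simp
  qed
  have "B q z = (- 1) ^ q * fact q * R q z" if "z > 0" for q z
    using that
  proof (induction q arbitrary: z)
    case 0
    then show ?case
      by (simp add: B_def R_def g_def F0 signed_stirling_def)
  next
    case (Suc q)
    have "((\<lambda>z. (- 1) ^ q * fact q * R q z) has_real_derivative
        (- 1) ^ q * fact q * - (z ^ q * F (Suc q) z / fact q)) (at z)"
      by (intro DERIV_cmult R' Suc.prems)
    \<comment> \<open>The induction hypothesis is an equality for positive arguments only; it passes
      to derivatives because the half-line is open. Comparison with \<open>B'\<close> then
      determines \<open>B (Suc q)\<close>.\<close>
    then have "(B q has_real_derivative (- 1) ^ q * fact q * - (z ^ q * F (Suc q) z / fact q)) (at z)"
      by (rule DERIV_cong_ev[THEN iffD2, rotated -1])
        (use Suc.IH Suc.prems eventually_nhds_in_open[of "{0<..}" z] in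
          \<open>auto elim!: eventually_mono\<close>)
    from DERIV_unique[OF B'[OF Suc.prems] this]
    have "B (Suc q) z = (- 1) ^ Suc q * (z ^ Suc q * F (Suc q) z)
        + (- 1) ^ Suc q * fact (Suc q) * R q z"
      using Suc.prems Suc.IH[OF Suc.prems] by (simp add: field_simps)
    also have "\<dots> = (- 1) ^ Suc q * fact (Suc q) * R (Suc q) z"
      by (simp add: R_def distrib_left del: fact_Suc)
    finally show ?case .
  qed
  from this[OF \<open>z > 0\<close>, of q] show ?thesis
    by (simp add: B_def R_def g_def sum_distrib_left sum_distrib_right atLeast0AtMost mult_ac)
qed

subsection \<open>The distribution of the ratio\<close>

context prob_space
begin

lemma prob_gamma_le_mult:
  assumes W: "distributed M lborel W (gamma_density (real m) \<theta>)" and m: "m > 0" and \<theta>: "\<theta> > 0"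
    and T[measurable]: "T \<in> borel_measurable M" and T_nonneg: "AE \<omega> in M. 0 \<le> T \<omega>"
    and prod: "distr M (borel \<Otimes>\<^sub>M borel) (\<lambda>\<omega>. (T \<omega>, W \<omega>)) = distr M borel T \<Otimes>\<^sub>M distr M borel W"
    and \<beta>: "\<beta> > 0"
  shows "prob {\<omega> \<in> space M. W \<omega> \<le> \<beta> * T \<omega>}
    = 1 - (\<Sum>k<m. (\<beta> / \<theta>) ^ k / fact k * expectation (\<lambda>\<omega>. T \<omega> ^ k * exp (- (\<beta> / \<theta> * T \<omega>))))"
proof -
  obtain N where N: "m = Suc N"
    using m by (cases m) auto
  let ?z = "\<beta> / \<theta>"
  let ?G = "\<lambda>\<omega>. 1 - (\<Sum>k<m. ?z ^ k / fact k * (T \<omega> ^ k * exp (- (?z * T \<omega>))))"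
  have z: "?z > 0"
    using \<beta> \<theta> by simp
  have W_meas[measurable]: "W \<in> borel_measurable M"
    using distributed_measurable[OF W] by simp
  have W_erlang: "distributed M lborel W (erlang_density N (1 / \<theta>))"
    using W unfolding N
    by (rule distributed_cong_density[THEN iffD1, rotated -1])
      (use AE_lborel_singleton[of "0::real"] in
        \<open>auto elim!: eventually_mono simp: gamma_density_Suc_eq_erlang_density \<theta> simp del: of_nat_Suc\<close>)
  interpret W: prob_space "distr M borel W"
    by (rule prob_space_distr) simp
  have W_cdf: "emeasure (distr M borel W) {..a} = ennreal (erlang_CDF N (1 / \<theta>) a)" for a
  proof -
    have "emeasure (distr M borel W) {..a} = emeasure (distr M lborel W) {..a}"
      by (intro arg_cong2[where f = emeasure] distr_cong) auto
    also have "\<dots> = ennreal (erlang_CDF N (1 / \<theta>) a)"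
      using \<theta> by (simp add: distributed_distr_eq_density[OF W_erlang] emeasure_erlang_density)
    finally show ?thesis .
  qed
  have int: "integrable M (\<lambda>\<omega>. T \<omega> ^ k * exp (- (?z * T \<omega>)))" for k
    by (intro integrable_power_exp T T_nonneg z)
  \<comment> \<open>The sign of \<open>t\<close> matters: \<open>erlang_CDF\<close> is
    \<open>0\<close> at negative arguments, where the closed form is not.\<close>
  have CDF: "erlang_CDF N (1 / \<theta>) (\<beta> * t) = 1 - (\<Sum>k<m. ?z ^ k / fact k * (t ^ k * exp (- (?z * t))))"
    if "t \<ge> 0" for t
    using that \<beta> by (simp add: erlang_CDF_def N lessThan_Suc_atMost power_mult_distrib power_divide mult_less_0_iff mult_ac)
  have G_nonneg: "AE \<omega> in M. 0 \<le> ?G \<omega>"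
    using T_nonneg
  proof eventually_elim
    case (elim \<omega>)
    have "0 \<le> erlang_CDF N (1 / \<theta>) (\<beta> * T \<omega>)"
      using \<theta> by simp
    then show ?case
      unfolding CDF[OF elim] .
  qed
  have "emeasure M {\<omega> \<in> space M. W \<omega> \<le> \<beta> * T \<omega>}
      = (\<integral>\<^sup>+\<omega>. indicator {\<omega> \<in> space M. W \<omega> \<le> \<beta> * T \<omega>} \<omega> \<partial>M)"
    by simp
  also have "\<dots> = (\<integral>\<^sup>+\<omega>. indicator {(t, w). w \<le> \<beta> * t} (T \<omega>, W \<omega>) \<partial>M)"
    by (intro nn_integral_cong) (simp add: indicator_def)
  also have "\<dots> = (\<integral>\<^sup>+p. indicator {(t, w). w \<le> \<beta> * t} p \<partial>(distr M borel T \<Otimes>\<^sub>M distr M borel W))"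
    unfolding prod[symmetric] by (subst nn_integral_distr) auto
  also have "\<dots> = (\<integral>\<^sup>+t. \<integral>\<^sup>+w. indicator {(t, w). w \<le> \<beta> * t} (t, w) \<partial>distr M borel W \<partial>distr M borel T)"
    by (rule W.nn_integral_fst[symmetric]) measurable
  also have "\<dots> = (\<integral>\<^sup>+t. ennreal (erlang_CDF N (1 / \<theta>) (\<beta> * t)) \<partial>distr M borel T)"
  proof (rule nn_integral_cong)
    fix t
    have "(\<integral>\<^sup>+w. indicator {(t, w). w \<le> \<beta> * t} (t, w) \<partial>distr M borel W)
        = (\<integral>\<^sup>+w. indicator {..\<beta> * t} w \<partial>distr M borel W)"
      by (intro nn_integral_cong) (auto simp: indicator_def)
    then show "(\<integral>\<^sup>+w. indicator {(t, w). w \<le> \<beta> * t} (t, w) \<partial>distr M borel W)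
        = ennreal (erlang_CDF N (1 / \<theta>) (\<beta> * t))"
      by (simp add: W_cdf)
  qed
  also have "\<dots> = (\<integral>\<^sup>+\<omega>. ennreal (erlang_CDF N (1 / \<theta>) (\<beta> * T \<omega>)) \<partial>M)"
    by (subst nn_integral_distr) (auto simp: erlang_CDF_def[abs_def])
  also have "\<dots> = (\<integral>\<^sup>+\<omega>. ennreal (?G \<omega>) \<partial>M)"
    using T_nonneg by (intro nn_integral_cong_AE) (auto elim!: eventually_mono simp: CDF)
  also have "\<dots> = ennreal (expectation ?G)"
    by (intro nn_integral_eq_integral G_nonneg Bochner_Integration.integrable_diff
        Bochner_Integration.integrable_sum integrable_mult_right int integrable_const)
  finally have "prob {\<omega> \<in> space M. W \<omega> \<le> \<beta> * T \<omega>} = expectation ?G"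
    using integral_nonneg_AE[OF G_nonneg] by (simp add: emeasure_eq_measure)
  also have "\<dots> = 1 - (\<Sum>k<m. ?z ^ k / fact k * expectation (\<lambda>\<omega>. T \<omega> ^ k * exp (- (?z * T \<omega>))))"
    using int by (subst Bochner_Integration.integral_diff) (auto simp: prob_space Bochner_Integration.integral_sum)
  finally show ?thesis .
qed

lemma expectation_power_exp_add:
  assumes U[measurable]: "U \<in> borel_measurable M" and V[measurable]: "V \<in> borel_measurable M"
    and nonneg: "AE \<omega> in M. 0 \<le> U \<omega>" "AE \<omega> in M. 0 \<le> V \<omega>"
    and prod: "distr M (borel \<Otimes>\<^sub>M borel) (\<lambda>\<omega>. (U \<omega>, V \<omega>)) = distr M borel U \<Otimes>\<^sub>M distr M borel V"
    and z: "z > 0"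
  shows "expectation (\<lambda>\<omega>. (U \<omega> + V \<omega>) ^ k * exp (- (z * (U \<omega> + V \<omega>))))
    = (\<Sum>l\<le>k. real (k choose l) * expectation (\<lambda>\<omega>. U \<omega> ^ l * exp (- (z * U \<omega>)))
        * expectation (\<lambda>\<omega>. V \<omega> ^ (k - l) * exp (- (z * V \<omega>))))"
proof -
  let ?u = "\<lambda>l \<omega>. U \<omega> ^ l * exp (- (z * U \<omega>))" and ?v = "\<lambda>l \<omega>. V \<omega> ^ l * exp (- (z * V \<omega>))"
  have UV: "indep_var borel U borel V"
    unfolding indep_var_distribution_eq using prod by simp
  have indep: "indep_var borel (?u l) borel (?v j)" for l j
    using indep_var_compose[OF UV, of "\<lambda>x. x ^ l * exp (- (z * x))" borel "\<lambda>x. x ^ j * exp (- (z * x))" borel]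
    by (simp add: comp_def)
  have int: "integrable M (?u l)" "integrable M (?v l)" for l
    using integrable_power_exp[OF U nonneg(1) z] integrable_power_exp[OF V nonneg(2) z] by auto
  have exp_eq: "exp (- (z * (U \<omega> + V \<omega>))) = exp (- (z * U \<omega>)) * exp (- (z * V \<omega>))" for \<omega>
    by (simp add: distrib_left flip: exp_add)
  have "(U \<omega> + V \<omega>) ^ k * exp (- (z * (U \<omega> + V \<omega>)))
      = (\<Sum>l\<le>k. real (k choose l) * (?u l \<omega> * ?v (k - l) \<omega>))" for \<omega>
    unfolding exp_eq binomial_ring sum_distrib_right by (intro sum.cong) (simp_all add: mult_ac)

  then have "expectation (\<lambda>\<omega>. (U \<omega> + V \<omega>) ^ k * exp (- (z * (U \<omega> + V \<omega>))))
      = (\<Sum>l\<le>k. real (k choose l) * expectation (\<lambda>\<omega>. ?u l \<omega> * ?v (k - l) \<omega>))"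
    using indep_var_integrable[OF indep int] by (simp add: Bochner_Integration.integral_sum)
  then show ?thesis
    unfolding indep_var_lebesgue_integral[OF indep int] by (simp only: mult.assoc)
qed

lemma gamma_expectation_exp_power:
  assumes Y: "distributed M lborel Y (gamma_density u t)" and "u > 0" "t > 0" "z > 0"
  shows "expectation (\<lambda>\<omega>. exp (- (z * Y \<omega>)) * Y \<omega> ^ \<tau>)
    = Gamma (real \<tau> + u) / (Gamma u * t powr u) * (z + 1 / t) powr (- real \<tau> - u)"
proof -
  have "expectation (\<lambda>\<omega>. exp (- (z * Y \<omega>)) * Y \<omega> ^ \<tau>)
      = (\<integral>x. gamma_density u t x * (exp (- (z * x)) * x ^ \<tau>) \<partial>lborel)"
    by (rule distributed_integral[OF Y, symmetric]) (auto simp: gamma_density_nonneg assms)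
  also have "\<dots> = Gamma (real \<tau> + u) / (Gamma u * t powr u) * (z + 1 / t) powr (- real \<tau> - u)"
  proof (rule has_bochner_integral_integral_eq, rule has_bochner_integral_nn_integral)
    have "(\<integral>\<^sup>+x. ennreal (gamma_density u t x * (exp (- (z * x)) * x ^ \<tau>)) \<partial>lborel)
        = (\<integral>\<^sup>+x. ennreal (gamma_density u t x) * ennreal (x powr real \<tau> * exp (- z * x)) \<partial>lborel)"
      \<comment> \<open>For \<open>\<tau> = 0\<close> the functions
        \<open>x powr real \<tau>\<close> and \<open>x ^ \<tau>\<close> disagree at
        \<open>0\<close>, so they are compared off that point.\<close>
      using AE_lborel_singleton[of "0::real"]
    proof (intro nn_integral_cong_AE, eventually_elim)
      case (elim x)
      then show ?case
        using assms by (cases "x < 0")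
          (auto simp: gamma_density_def powr_realpow mult_ac simp flip: ennreal_mult')
    qed
    also have "\<dots> = ennreal (Gamma (u + real \<tau>) / (Gamma u * t powr u) * (z + 1 / t) powr (- real \<tau> - u))"
      using assms by (intro nn_integral_gamma_powr_exp) auto
    finally show "(\<integral>\<^sup>+x. ennreal (gamma_density u t x * (exp (- (z * x)) * x ^ \<tau>)) \<partial>lborel)
        = ennreal (Gamma (real \<tau> + u) / (Gamma u * t powr u) * (z + 1 / t) powr (- real \<tau> - u))"
      by (simp add: add.commute)
    show "AE x in lborel. 0 \<le> gamma_density u t x * (exp (- (z * x)) * x ^ \<tau>)"
      using assms by (intro AE_I2) (auto simp: gamma_density_def)
    show "0 \<le> Gamma (real \<tau> + u) / (Gamma u * t powr u) * (z + 1 / t) powr (- real \<tau> - u)"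
      using assms by (intro mult_nonneg_nonneg divide_nonneg_nonneg) auto
  qed measurable
  finally show ?thesis .
qed

end

text \<open>The factorials turn the binomial convolution into an ordinary one over the triangle
  \<open>l + r \<le> N\<close>. Summing over \<open>r\<close> first leaves, for each
  \<open>l\<close>, a partial sum of tilted moments cut off at \<open>N - l\<close>, the form in
  which the Stirling identity applies.\<close>

lemma sum_binomial_regroup:
  fixes A F :: "nat \<Rightarrow> real" and z :: real
  shows "(\<Sum>k\<le>N. z ^ k / fact k * (\<Sum>l\<le>k. real (k choose l) * A l * F (k - l)))
    = (\<Sum>l\<le>N. z ^ l / fact l * A l * (\<Sum>r\<le>N - l. z ^ r * F r / fact r))"
proof -
  let ?g = "\<lambda>l r. z ^ l / fact l * A l * (z ^ r * F r / fact r)"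
  have "(\<Sum>k\<le>N. z ^ k / fact k * (\<Sum>l\<le>k. real (k choose l) * A l * F (k - l)))
      = (\<Sum>k\<le>N. \<Sum>l\<le>k. ?g l (k - l))"
    unfolding sum_distrib_left
  proof (intro sum.cong refl)
    fix k l :: nat assume "l \<in> {..k}"
    then have "real (k choose l) = fact k / (fact l * fact (k - l))" "z ^ k = z ^ l * z ^ (k - l)"
      by (simp_all add: binomial_fact flip: power_add)
    then show "z ^ k / fact k * (real (k choose l) * A l * F (k - l)) = ?g l (k - l)"
      by simp
  qed
  also have "\<dots> = (\<Sum>(l, r)\<in>{(l, r). l + r \<le> N}. ?g l r)"
    by (rule sum.triangle_reindex_eq[symmetric])
  also have "{(l, r). l + r \<le> N} = Sigma {..N} (\<lambda>l. {..N - l})"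
    by auto
  also have "(\<Sum>(l, r)\<in>Sigma {..N} (\<lambda>l. {..N - l}). ?g l r) = (\<Sum>l\<le>N. \<Sum>r\<le>N - l. ?g l r)"
    by (rule sum.Sigma[symmetric]) auto
  finally show ?thesis
    by (simp add: sum_distrib_left)
qed

context prob_space
begin

text \<open>Grouping the constant noise \<open>1\<close> with \<open>Y\<close> produces the factor
  \<open>exp (- z)\<close> and the innermost binomial sum, and leaves the interference
  untouched.\<close>

lemma expectation_exp_power_one_plus:
  assumes Y[measurable]: "Y \<in> borel_measurable M" and "AE \<omega> in M. 0 \<le> Y \<omega>" and "z > 0"
  shows "expectation (\<lambda>\<omega>. (Y \<omega> + 1) ^ l * exp (- (z * (Y \<omega> + 1))))
    = exp (- z) * (\<Sum>\<tau>\<le>l. real (l choose \<tau>) * expectation (\<lambda>\<omega>. exp (- (z * Y \<omega>)) * Y \<omega> ^ \<tau>))"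
proof -
  have exp_eq: "exp (- (z * (Y \<omega> + 1))) = exp (- z) * exp (- (z * Y \<omega>))" for \<omega>
    by (simp add: distrib_left flip: exp_add)
  have "(Y \<omega> + 1) ^ l * exp (- (z * (Y \<omega> + 1)))
      = (\<Sum>\<tau>\<le>l. exp (- z) * (real (l choose \<tau>) * (exp (- (z * Y \<omega>)) * Y \<omega> ^ \<tau>)))" for \<omega>
    unfolding exp_eq binomial_ring sum_distrib_right by (intro sum.cong) (simp_all add: mult_ac)
  moreover have "integrable M (\<lambda>\<omega>. exp (- (z * Y \<omega>)) * Y \<omega> ^ \<tau>)" for \<tau>
    using integrable_power_exp[OF assms, of \<tau>] by (simp add: mult.commute)
  ultimately show ?thesis
    by (simp add: Bochner_Integration.integral_sum sum_distrib_left)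
qed

end

theorem theorem1:
  fixes M :: "'a measure"
    and \<alpha> lam p \<theta> \<Omega> n \<beta> :: real
    and m :: nat
    and W Y :: "'a \<Rightarrow> real"
    and X :: "nat \<Rightarrow> 'a \<Rightarrow> real^2"
    and \<Psi> :: "nat \<Rightarrow> 'a \<Rightarrow> real"
  assumes "prob_space M"
    and "\<alpha> > 2" and "lam > 0" and "0 < p" and "p \<le> 1"
    and "\<theta> > 0" and "\<Omega> > 0" and "n > 0" and "m > 0"
    and W: "distributed M lborel W (gamma_density (real m) \<theta>)"
    and X: "homogeneous_PPP M (p * lam) X"
    and \<Psi>_distr: "\<And>l. distributed M lborel (\<Psi> l) (gamma_density n \<Omega>)"
    and \<Psi>_indep: "prob_space.indep_vars M (\<lambda>_. borel) \<Psi> UNIV"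
    and Y: "(\<exists>u>0. \<exists>\<Upsilon>>0. distributed M lborel Y (gamma_density u \<Upsilon>)) \<or>
            (\<forall>\<omega>\<in>space M. Y \<omega> = 0)"
    and indep: "prob_space.indep_sets M
      (\<lambda>k::nat. [generated_events M borel W,
                 generated_events M borel Y,
                 generated_events M (\<Pi>\<^sub>M l\<in>UNIV. borel) (\<lambda>\<omega> l. X l \<omega>),
                 generated_events M (\<Pi>\<^sub>M l\<in>UNIV. borel) (\<lambda>\<omega> l. \<Psi> l \<omega>)] ! k) {..<4}"
    and "\<beta> > 0"
  shows "cdf (distr M borel (sinr \<alpha> W Y X \<Psi>)) \<beta> =
      1 - (- 1) ^ (m - 1)
            * exp (- lam * (\<beta> * \<Omega> / \<theta>) powr (2 / \<alpha>) * eta \<alpha> p n) * exp (- \<beta> / \<theta>)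
            / Gamma (real m)
          * (\<Sum>l = 0..m - 1. real ((m - 1) choose l) * (- \<beta> / \<theta>) ^ l
             * (\<Sum>i = 0..m - l - 1. real_of_int (signed_stirling (m - l) (i + 1)) * (2 / \<alpha>) ^ i
                * (\<Sum>j = 0..i. real (Stirling i j)
                   * (- lam * (\<beta> * \<Omega> / \<theta>) powr (2 / \<alpha>) * eta \<alpha> p n) ^ j))
             * (\<Sum>\<tau> = 0..l. real (l choose \<tau>)
                * (\<integral>\<omega>. exp (- \<beta> * Y \<omega> / \<theta>) * Y \<omega> ^ \<tau> \<partial>M)))
    \<and> (\<forall>u>0. \<forall>\<Upsilon>>0. distributed M lborel Y (gamma_density u \<Upsilon>) \<longrightarrow>
         (\<forall>\<tau>::nat. (\<integral>\<omega>. exp (- \<beta> * Y \<omega> / \<theta>) * Y \<omega> ^ \<tau> \<partial>M) =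
            Gamma (real \<tau> + u) / (Gamma u * \<Upsilon> powr u)
              * (\<beta> / \<theta> + 1 / \<Upsilon>) powr (- real \<tau> - u)))"
proof
  interpret prob_space M by fact
  define z where "z = \<beta> / \<theta>"
  have z: "z > 0"
    using \<open>\<beta> > 0\<close> \<open>\<theta> > 0\<close> by (simp add: z_def)
  have exp_Y: "exp (- \<beta> * Y \<omega> / \<theta>) = exp (- (z * Y \<omega>))" for \<omega>
    by (simp add: z_def)

  have [measurable]: "W \<in> borel_measurable M" "X l \<in> borel_measurable M" "\<Psi> l \<in> borel_measurable M" for l
    using distributed_measurable[OF W] X distributed_measurable[OF \<Psi>_distr[of l]]
    by (auto simp: homogeneous_PPP_def)
  have Y_meas[measurable]: "Y \<in> borel_measurable M"
  proof -
    have "Y \<in> borel_measurable M" if "distributed M lborel Y (gamma_density u t)" for u t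
      using distributed_measurable[OF that] by simp
    moreover have "Y \<in> borel_measurable M" if "\<forall>\<omega>\<in>space M. Y \<omega> = 0"
      using that by (subst measurable_cong[where g = "\<lambda>_. 0"]) auto
    ultimately show ?thesis
      using Y by blast
  qed
  have Y_nonneg: "AE \<omega> in M. 0 \<le> Y \<omega>"
    using Y AE_gamma_nonneg[of Y] by auto

  let ?PX = "\<Pi>\<^sub>M l\<in>(UNIV::nat set). (borel :: (real^2) measure)"
  let ?P\<Psi> = "\<Pi>\<^sub>M l\<in>(UNIV::nat set). (borel :: real measure)"
  define Fam where "Fam = (\<lambda>k::nat. [generated_events M borel W, generated_events M borel Y,
      generated_events M ?PX (\<lambda>\<omega> l. X l \<omega>), generated_events M ?P\<Psi> (\<lambda>\<omega> l. \<Psi> l \<omega>)] ! k)"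
  have Fam: "Fam 0 = generated_events M borel W" "Fam 1 = generated_events M borel Y"
      "Fam 2 = generated_events M ?PX (\<lambda>\<omega> l. X l \<omega>)" "Fam 3 = generated_events M ?P\<Psi> (\<lambda>\<omega> l. \<Psi> l \<omega>)"
    by (simp_all add: Fam_def eval_nat_numeral)
  have indep_Fam: "indep_sets Fam {..<4}"
    using indep by (simp add: Fam_def)
  have stable: "Int_stable (Fam k)" if "k \<in> {..<4}" for k
    using that Fam by (auto simp: eval_nat_numeral less_Suc_eq Int_stable_generated_events)
  have Pow: "(\<Union>k\<in>A. Fam k) \<subseteq> Pow (space M)" if "A \<subseteq> {..<4}" for A
    using indep_Fam that sets.space_closed[of M] unfolding indep_sets_def by blast

  \<comment> \<open>Index 0 stands for \<open>W\<close>, 1 for \<open>Y\<close>, 2 for the points, 3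
    for the marks. Block {2, 3} carries \<open>I\<close>, and block {1, 2, 3} carries the
    denominator \<open>T\<close>.\<close>
  define \<sigma> where "\<sigma> A = sigma (space M) (\<Union>k\<in>A. Fam k)" for A
  have \<sigma>_W: "W \<in> measurable (\<sigma> A) borel" if "0 \<in> A" "A \<subseteq> {..<4}" for A
    unfolding \<sigma>_def using that Fam by (intro measurable_generated_events Pow) auto
  have \<sigma>_Y: "Y \<in> measurable (\<sigma> A) borel" if "1 \<in> A" "A \<subseteq> {..<4}" for A
    unfolding \<sigma>_def using that Fam by (intro measurable_generated_events Pow) auto
  have \<sigma>_X: "(\<lambda>\<omega> l. X l \<omega>) \<in> measurable (\<sigma> A) ?PX" if "2 \<in> A" "A \<subseteq> {..<4}" for A
    unfolding \<sigma>_def using that Fam by (intro measurable_generated_events Pow) (auto simp: space_PiM)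
  have \<sigma>_\<Psi>: "(\<lambda>\<omega> l. \<Psi> l \<omega>) \<in> measurable (\<sigma> A) ?P\<Psi>" if "3 \<in> A" "A \<subseteq> {..<4}" for A
    unfolding \<sigma>_def using that Fam by (intro measurable_generated_events Pow) (auto simp: space_PiM)
  note pair = distr_Pair_eq_pair_measure[OF indep_Fam stable, folded \<sigma>_def]

  define I where "I \<omega> = (\<Sum>l. norm (X l \<omega>) powr (- \<alpha>) * \<Psi> l \<omega>)" for \<omega>
  have \<sigma>_I: "I \<in> measurable (\<sigma> A) borel" if "2 \<in> A" "3 \<in> A" "A \<subseteq> {..<4}" for A
  proof -
    have [measurable]: "X l \<in> measurable (\<sigma> A) borel" "\<Psi> l \<in> measurable (\<sigma> A) borel" for l
      using measurable_compose[OF \<sigma>_X measurable_component_singleton, of A l]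
        measurable_compose[OF \<sigma>_\<Psi> measurable_component_singleton, of A l] that by auto
    show ?thesis
      unfolding I_def[abs_def] by measurable
  qed
  have prod_X_\<Psi>: "distr M (?PX \<Otimes>\<^sub>M ?P\<Psi>) (\<lambda>\<omega>. (\<lambda>l. X l \<omega>, \<lambda>l. \<Psi> l \<omega>))
      = distr M ?PX (\<lambda>\<omega> l. X l \<omega>) \<Otimes>\<^sub>M distr M ?P\<Psi> (\<lambda>\<omega> l. \<Psi> l \<omega>)"
    by (rule pair(3)[where A = "{2}" and B = "{3}"]) (auto intro!: \<sigma>_X \<sigma>_\<Psi>)
  define T where "T \<omega> = (Y \<omega> + 1) + I \<omega>" for \<omega>
  have Y1: "(\<lambda>\<omega>. Y \<omega> + 1) \<in> measurable (\<sigma> A) borel" if "1 \<in> A" "A \<subseteq> {..<4}" for A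
    using \<sigma>_Y[OF that] by measurable
  have \<sigma>_T: "T \<in> measurable (\<sigma> {1, 2, 3}) borel"
    unfolding T_def[abs_def] by (intro borel_measurable_add Y1 \<sigma>_I) auto
  have prod_Y_I: "distr M (borel \<Otimes>\<^sub>M borel) (\<lambda>\<omega>. (Y \<omega> + 1, I \<omega>))
      = distr M borel (\<lambda>\<omega>. Y \<omega> + 1) \<Otimes>\<^sub>M distr M borel I"
    by (rule pair(3)[where A = "{1}" and B = "{2, 3}"]) (auto intro!: Y1 \<sigma>_I)
  have prod_T_W: "distr M (borel \<Otimes>\<^sub>M borel) (\<lambda>\<omega>. (T \<omega>, W \<omega>)) = distr M borel T \<Otimes>\<^sub>M distr M borel W"
    by (rule pair(3)[where A = "{1, 2, 3}" and B = "{0}"]) (auto intro!: \<sigma>_T[unfolded One_nat_def] \<sigma>_W)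

  have [measurable]: "I \<in> borel_measurable M" "T \<in> borel_measurable M"
    unfolding T_def[abs_def] I_def[abs_def] by measurable
  have plam: "p * lam \<ge> 0"
    using \<open>0 < p\<close> \<open>lam > 0\<close> by simp
  note interference = \<open>\<alpha> > 2\<close> plam \<open>n > 0\<close> \<open>\<Omega> > 0\<close> X \<Psi>_distr \<Psi>_indep prod_X_\<Psi>
  have I_nonneg: "AE \<omega> in M. 0 \<le> I \<omega>"
    unfolding I_def by (rule AE_interference_nonneg[OF interference])
  have T_ge_1: "AE \<omega> in M. 1 \<le> T \<omega>"
    using I_nonneg Y_nonneg by eventually_elim (simp add: T_def)

  \<comment> \<open>\<open>C\<close> equals
    \<open>lam * eta \<alpha> p n * \<Omega> powr (2 / \<alpha>)\<close>, so that
    \<open>C * z powr (2 / \<alpha>)\<close> is the exponent \<open>K\<close> of the claim.\<close>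
  define C where "C = p * lam * (pi * \<Omega> powr (2 / \<alpha>) * Gamma (n + 2 / \<alpha>) * Gamma (1 - 2 / \<alpha>) / Gamma n)"
  define F where "F r s = expectation (\<lambda>\<omega>. I \<omega> ^ r * exp (- (s * I \<omega>)))" for r s
  have F0: "F 0 s = exp (- C * s powr (2 / \<alpha>))" if "s > 0" for s
    using Laplace_interference[OF interference that] by (simp add: F_def I_def C_def)
  have F': "(F r has_real_derivative - F (Suc r) s) (at s)" if "s > 0" for r s
    unfolding F_def[abs_def] by (rule has_derivative_expectation_power_exp[OF _ I_nonneg that]) measurable
  define K where "K = lam * (\<beta> * \<Omega> / \<theta>) powr (2 / \<alpha>) * eta \<alpha> p n"
  have K: "C * z powr (2 / \<alpha>) = K"
  proof -
    have "(\<beta> * \<Omega> / \<theta>) powr (2 / \<alpha>) = z powr (2 / \<alpha>) * \<Omega> powr (2 / \<alpha>)"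
      using \<open>\<Omega> > 0\<close> z by (simp add: z_def flip: powr_mult)
    then show ?thesis
      by (simp add: C_def K_def eta_def)
  qed
  \<comment> \<open>\<open>S (N - l)\<close>, where \<open>N\<close> is \<open>m - 1\<close>, is the
    double Stirling sum in the summand \<open>l\<close> of the claim.\<close>
  define S where "S q = (\<Sum>i = 0..q. real_of_int (signed_stirling (Suc q) (i + 1)) * (2 / \<alpha>) ^ i
      * (\<Sum>j = 0..i. real (Stirling i j) * (- K) ^ j))" for q
  have S: "S q * exp (- K) = (- 1) ^ q * fact q * (\<Sum>r\<le>q. z ^ r * F r z / fact r)" for q
    using stirling_Touchard_eq_moments[of F C "2 / \<alpha>" z q, OF F' F0 z] by (simp add: S_def K)
  define V where "V \<tau> = expectation (\<lambda>\<omega>. exp (- (z * Y \<omega>)) * Y \<omega> ^ \<tau>)" for \<tau>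
  define U where "U l = (\<Sum>\<tau>\<le>l. real (l choose \<tau>) * V \<tau>)" for l
  obtain N where N: "m = Suc N"
    using \<open>m > 0\<close> by (cases m) auto

  have moment_T: "expectation (\<lambda>\<omega>. T \<omega> ^ k * exp (- (z * T \<omega>)))
      = (\<Sum>l\<le>k. real (k choose l) * (exp (- z) * U l) * F (k - l) z)" for k
  proof -
    have "AE \<omega> in M. 0 \<le> Y \<omega> + 1"
      using Y_nonneg by eventually_elim simp
    then have "expectation (\<lambda>\<omega>. T \<omega> ^ k * exp (- (z * T \<omega>)))
        = (\<Sum>l\<le>k. real (k choose l) * expectation (\<lambda>\<omega>. (Y \<omega> + 1) ^ l * exp (- (z * (Y \<omega> + 1))))
          * F (k - l) z)"
      unfolding T_def F_def by (intro expectation_power_exp_add prod_Y_I I_nonneg z) measurable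
    then show ?thesis
      by (simp add: expectation_exp_power_one_plus[OF Y_meas Y_nonneg z] U_def V_def)
  qed

  have "cdf (distr M borel (sinr \<alpha> W Y X \<Psi>)) \<beta> = prob {\<omega> \<in> space M. sinr \<alpha> W Y X \<Psi> \<omega> \<le> \<beta>}"
  proof -
    have "sinr \<alpha> W Y X \<Psi> \<in> borel_measurable M"
      unfolding sinr_def[abs_def] by measurable
    then show ?thesis
      unfolding cdf_def by (subst measure_distr) (auto intro!: arg_cong[where f = prob])
  qed
  \<comment> \<open>Almost surely \<open>T \<ge> 1\<close>, so the ratio may be multiplied out. Junk
    values of the series need no separate treatment, as both events use the same
    \<open>I\<close>.\<close>
  also have "\<dots> = prob {\<omega> \<in> space M. W \<omega> \<le> \<beta> * T \<omega>}"
  proof (rule measure_eq_AE)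
    show "AE \<omega> in M. (\<omega> \<in> {\<omega> \<in> space M. sinr \<alpha> W Y X \<Psi> \<omega> \<le> \<beta>})
        = (\<omega> \<in> {\<omega> \<in> space M. W \<omega> \<le> \<beta> * T \<omega>})"
      using T_ge_1
    proof eventually_elim
      case (elim \<omega>)
      have "sinr \<alpha> W Y X \<Psi> \<omega> = W \<omega> / T \<omega>"
        by (simp add: sinr_def T_def I_def algebra_simps)
      then show ?case
        using elim by (simp add: pos_divide_le_eq)
    qed
    show "{\<omega> \<in> space M. sinr \<alpha> W Y X \<Psi> \<omega> \<le> \<beta>} \<in> events"
      unfolding sinr_def[abs_def] by measurable
  qed measurable
  also have "\<dots> = 1 - (\<Sum>k\<le>N. z ^ k / fact k * expectation (\<lambda>\<omega>. T \<omega> ^ k * exp (- (z * T \<omega>))))"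
  proof -
    have "AE \<omega> in M. 0 \<le> T \<omega>"
      using T_ge_1 by eventually_elim simp
    then show ?thesis
      unfolding z_def lessThan_Suc_atMost[symmetric] N[symmetric]
      by (intro prob_gamma_le_mult[OF W \<open>m > 0\<close> \<open>\<theta> > 0\<close> _ _ prod_T_W \<open>\<beta> > 0\<close>]) measurable
  qed
  also have "(\<Sum>k\<le>N. z ^ k / fact k * expectation (\<lambda>\<omega>. T \<omega> ^ k * exp (- (z * T \<omega>))))
      = (\<Sum>l\<le>N. z ^ l / fact l * (exp (- z) * U l) * (\<Sum>r\<le>N - l. z ^ r * F r z / fact r))"
    unfolding moment_T by (rule sum_binomial_regroup)
  \<comment> \<open>The factorials of \<open>l\<close> and \<open>N - l\<close> combine to a
    binomial coefficient over \<open>fact N\<close>, which is \<open>Gamma (real m)\<close>;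
    splitting the sign \<open>(- 1) ^ (N - l)\<close> turns \<open>z ^ l\<close> into
    \<open>(- z) ^ l\<close>.\<close>
  also have "\<dots> = (\<Sum>l\<le>N. (- 1) ^ N * exp (- K) * exp (- z) / fact N
      * (real (N choose l) * (- z) ^ l * S (N - l) * U l))"
  proof (intro sum.cong refl)
    fix l assume "l \<in> {..N}"
    then have l: "l \<le> N" by simp
    have R: "(\<Sum>r\<le>N - l. z ^ r * F r z / fact r) = (- 1) ^ (N - l) * (S (N - l) * exp (- K)) / fact (N - l)"
      unfolding S by (simp flip: power_add power_mult_distrib)
    have sign: "(- 1 :: real) ^ (N - l) = (- 1) ^ N * (- 1) ^ l"
      using l by (auto simp: minus_one_power_iff)
    have binom: "real (N choose l) / fact N = 1 / (fact l * fact (N - l))"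
      using l by (simp add: binomial_fact)
    have "(- 1) ^ N * exp (- K) * exp (- z) / fact N * (real (N choose l) * (- z) ^ l * S (N - l) * U l)
        = ((- 1) ^ N * (- 1) ^ l) * exp (- K) * exp (- z) * (real (N choose l) / fact N) * z ^ l * S (N - l) * U l"
      by (simp add: power_minus[of z])
    also have "\<dots> = z ^ l / fact l * (exp (- z) * U l) * (\<Sum>r\<le>N - l. z ^ r * F r z / fact r)"
      unfolding R sign binom by simp
    finally show "z ^ l / fact l * (exp (- z) * U l) * (\<Sum>r\<le>N - l. z ^ r * F r z / fact r)
        = (- 1) ^ N * exp (- K) * exp (- z) / fact N * (real (N choose l) * (- z) ^ l * S (N - l) * U l)" ..
  qed
  also have "\<dots> = (- 1) ^ N * exp (- K) * exp (- z) / fact N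
      * (\<Sum>l\<le>N. real (N choose l) * (- z) ^ l * S (N - l) * U l)"
    by (rule sum_distrib_left[symmetric])

  also have "\<dots> = (- 1) ^ (m - 1)
            * exp (- lam * (\<beta> * \<Omega> / \<theta>) powr (2 / \<alpha>) * eta \<alpha> p n) * exp (- \<beta> / \<theta>)
            / Gamma (real m)
          * (\<Sum>l = 0..m - 1. real ((m - 1) choose l) * (- \<beta> / \<theta>) ^ l
             * (\<Sum>i = 0..m - l - 1. real_of_int (signed_stirling (m - l) (i + 1)) * (2 / \<alpha>) ^ i
                * (\<Sum>j = 0..i. real (Stirling i j)
                   * (- lam * (\<beta> * \<Omega> / \<theta>) powr (2 / \<alpha>) * eta \<alpha> p n) ^ j))
             * (\<Sum>\<tau> = 0..l. real (l choose \<tau>)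
                * (\<integral>\<omega>. exp (- \<beta> * Y \<omega> / \<theta>) * Y \<omega> ^ \<tau> \<partial>M)))"
  proof -
    have "- lam * (\<beta> * \<Omega> / \<theta>) powr (2 / \<alpha>) * eta \<alpha> p n = - K" "- \<beta> / \<theta> = - z"
      by (simp_all add: K_def z_def)
    moreover have "Gamma (real m) = fact N"
      using Gamma_fact[of N, where 'a = real] by (simp add: N)
    ultimately show ?thesis
      unfolding exp_Y
      \<comment> \<open>Rewriting \<open>Suc N - l\<close> as \<open>Suc (N - l)\<close> needs
        \<open>l \<le> N\<close>, which the congruence rule supplies from the summation
        range.\<close>
      by (simp add: N S_def U_def V_def atLeast0AtMost Suc_diff_le del: of_nat_Suc cong: sum.cong_simp)
  qed
  finally show "cdf (distr M borel (sinr \<alpha> W Y X \<Psi>)) \<beta> =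
      1 - (- 1) ^ (m - 1)
            * exp (- lam * (\<beta> * \<Omega> / \<theta>) powr (2 / \<alpha>) * eta \<alpha> p n) * exp (- \<beta> / \<theta>)
            / Gamma (real m)
          * (\<Sum>l = 0..m - 1. real ((m - 1) choose l) * (- \<beta> / \<theta>) ^ l
             * (\<Sum>i = 0..m - l - 1. real_of_int (signed_stirling (m - l) (i + 1)) * (2 / \<alpha>) ^ i
                * (\<Sum>j = 0..i. real (Stirling i j)
                   * (- lam * (\<beta> * \<Omega> / \<theta>) powr (2 / \<alpha>) * eta \<alpha> p n) ^ j))
             * (\<Sum>\<tau> = 0..l. real (l choose \<tau>)
                * (\<integral>\<omega>. exp (- \<beta> * Y \<omega> / \<theta>) * Y \<omega> ^ \<tau> \<partial>M)))" .
  show "\<forall>u>0. \<forall>\<Upsilon>>0. distributed M lborel Y (gamma_density u \<Upsilon>) \<longrightarrow>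
         (\<forall>\<tau>::nat. (\<integral>\<omega>. exp (- \<beta> * Y \<omega> / \<theta>) * Y \<omega> ^ \<tau> \<partial>M) =
            Gamma (real \<tau> + u) / (Gamma u * \<Upsilon> powr u)
              * (\<beta> / \<theta> + 1 / \<Upsilon>) powr (- real \<tau> - u))"
    unfolding exp_Y z_def[symmetric] using gamma_expectation_exp_power z by blast
qed

end
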